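(* Suppose that $X$ is a Polish space and $G$ is an acyclic locally finite Borel graph on $X$ of degree at least two and with no injective $G$-rays of $G$-degree two on even indices. Then there is a comeager $G$-invariant Borel set on which $G$ has a Borel perfect matching, i.e., a comeager $G$-invariant Borel set $C \subseteq X$ such that the restriction of $G$ to $C$ has a Borel perfect matching.
   Context: A graph on a set $X$ is an irreflexive symmetric subset $G$ of $X \times X$; it is Borel if it is a Borel subset of $X \times X$. The restriction of $G$ to $Y \subseteq X$ is $G \cap (Y \times Y)$, regarded as a graph on $Y$. A $G$-path is a finite sequence $(x_i)_{i \le n}$ with $x_i \mathrel{G} x_{i+1}$ for all $i < n$; $G$ is acyclic if there is at most one injective $G$-path between any two points. The connected components of $G$ are the classes of the smallest equivalence relation on $X$ containing $G$. A set is $G$-invariant if it is a union of connected components of $G$. The $G$-degree of $y$ is $\deg_G(y) = |\{x \in X : x \mathrel{G} y\}|$. $G$ is locally finite if every point has finite $G$-degree, and has degree at least $n$ if every point has $G$-degree at least $n$. A $G$-ray is a sequence $(x_n)_{n \in \mathbb{N}}$ with $x_n \mathrel{G} x_{n+1}$ for all $n$; it has $G$-degree two on even indices if $\deg_G(x_{2n}) = 2$ for all $n \in \mathbb{N}$. A matching of $G$ is an involution (a permutation that is its own inverse) of a subset of $X$ whose graph is contained in $G$; it is perfect if its domain is all of the vertex set. A matching is Borel if its domain is Borel and it is a Borel function. A set is meager if it is a countable union of nowhere dense sets, and comeager if its complement is meager. *)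

theory Defs
  imports "HOL-Analysis.Analysis"
begin

definition nowhere_dense :: "'a::topological_space set \<Rightarrow> bool" where
  "nowhere_dense A \<longleftrightarrow> interior (closure A) = {}"

definition meager :: "'a::topological_space set \<Rightarrow> bool" where
  "meager A \<longleftrightarrow> (\<exists>N :: nat \<Rightarrow> 'a set. (\<forall>n. nowhere_dense (N n)) \<and> A = (\<Union>n. N n))"

definition comeager :: "'a::topological_space set \<Rightarrow> bool" where
  "comeager A \<longleftrightarrow> meager (- A)"

definition graph_on :: "'a set \<Rightarrow> ('a \<times> 'a) set \<Rightarrow> bool" where
  "graph_on X G \<longleftrightarrow> G \<subseteq> X \<times> X \<and> irrefl G \<and> sym G"

text \<open>The remaining graph notions take the whole type as the vertex set, except for matchings.\<close>

definition graph_path :: "('a \<times> 'a) set \<Rightarrow> 'a list \<Rightarrow> bool" where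
  "graph_path G xs \<longleftrightarrow> xs \<noteq> [] \<and> (\<forall>i. Suc i < length xs \<longrightarrow> (xs ! i, xs ! Suc i) \<in> G)"

definition acyclic_graph :: "('a \<times> 'a) set \<Rightarrow> bool" where
  "acyclic_graph G \<longleftrightarrow>
    (\<forall>xs ys. graph_path G xs \<and> distinct xs \<and> graph_path G ys \<and> distinct ys \<and>
       hd xs = hd ys \<and> last xs = last ys \<longrightarrow> xs = ys)"

definition connectedness :: "('a \<times> 'a) set \<Rightarrow> ('a \<times> 'a) set" where
  "connectedness G = \<Inter>{E. equiv UNIV E \<and> G \<subseteq> E}"

definition connected_components :: "('a \<times> 'a) set \<Rightarrow> 'a set set" where
  "connected_components G = UNIV // connectedness G"

definition graph_invariant :: "('a \<times> 'a) set \<Rightarrow> 'a set \<Rightarrow> bool" where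
  "graph_invariant G A \<longleftrightarrow> (\<exists>K \<subseteq> connected_components G. A = \<Union>K)"

text \<open>Degrees are extended naturals because \<^const>\<open>card\<close> is \<open>0\<close> on infinite sets.\<close>

definition graph_degree :: "('a \<times> 'a) set \<Rightarrow> 'a \<Rightarrow> enat" where
  "graph_degree G y = (if finite {x. (x, y) \<in> G} then enat (card {x. (x, y) \<in> G}) else \<infinity>)"

definition locally_finite_graph :: "('a \<times> 'a) set \<Rightarrow> bool" where
  "locally_finite_graph G \<longleftrightarrow> (\<forall>y. graph_degree G y < \<infinity>)"

definition degree_at_least :: "nat \<Rightarrow> ('a \<times> 'a) set \<Rightarrow> bool" where
  "degree_at_least n G \<longleftrightarrow> (\<forall>y. enat n \<le> graph_degree G y)"

definition graph_ray :: "('a \<times> 'a) set \<Rightarrow> (nat \<Rightarrow> 'a) \<Rightarrow> bool" where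
  "graph_ray G x \<longleftrightarrow> (\<forall>n. (x n, x (Suc n)) \<in> G)"

definition degree_two_on_even :: "('a \<times> 'a) set \<Rightarrow> (nat \<Rightarrow> 'a) \<Rightarrow> bool" where
  "degree_two_on_even G x \<longleftrightarrow> (\<forall>n. graph_degree G (x (2 * n)) = 2)"

text \<open>A partial function is a domain \<open>D\<close> with a total function \<open>f\<close> whose values off \<open>D\<close> are
  irrelevant.\<close>

definition matching :: "'a set \<Rightarrow> ('a \<times> 'a) set \<Rightarrow> 'a set \<Rightarrow> ('a \<Rightarrow> 'a) \<Rightarrow> bool" where
  "matching X G D f \<longleftrightarrow>
    D \<subseteq> X \<and> bij_betw f D D \<and> (\<forall>x\<in>D. f (f x) = x) \<and> (\<forall>x\<in>D. (x, f x) \<in> G)"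

definition perfect_matching :: "'a set \<Rightarrow> ('a \<times> 'a) set \<Rightarrow> 'a set \<Rightarrow> ('a \<Rightarrow> 'a) \<Rightarrow> bool" where
  "perfect_matching X G D f \<longleftrightarrow> matching X G D f \<and> D = X"

definition borel_partial_function ::
    "'a::topological_space set \<Rightarrow> ('a \<Rightarrow> 'a) \<Rightarrow> bool" where
  "borel_partial_function D f \<longleftrightarrow>
    D \<in> sets borel \<and> f \<in> borel_measurable (restrict_space borel D)"

definition has_borel_perfect_matching ::
    "'a::topological_space set \<Rightarrow> ('a \<times> 'a) set \<Rightarrow> bool" where
  "has_borel_perfect_matching X G \<longleftrightarrow>
    (\<exists>D f. perfect_matching X G D f \<and> borel_partial_function D f)"

end

theory Submission
  imports Defs
begin

text \<open>
  Let $M$ be a matching and let $H$ be the graph that $G$ induces on the vertices not covered by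
  $M$.  Suppose that in $H$ every vertex has at least two neighbours and no injective ray has degree
  two on even indices.  Matching the two ends $x$, $y$ of an edge of $H$ takes a neighbour away from
  every vertex $z$ next to $x$ or $y$; if $z$ had only two neighbours, it must be matched with the
  other one, $w$, and then the neighbours of $w$ are in the same situation.  An infinite run of such
  forced moves would be a forbidden ray, so by local finiteness a single edge forces only finitely
  many others.  As $G$ is acyclic, these edges form a matching, and after their removal every vertex
  still has two neighbours: a vertex next to the removed piece had at least three and loses just one.

  Treating many edges at once might create new forbidden rays.  Such a ray runs past infinitely many
  removed pieces, and between two consecutive ones it is a run of moves that were forced before.
  So it is enough that the pieces, each enlarged by the forced runs that start at its boundary, lie
  at distance more than two from each other: \<open>extendable_match_forced\<close>.  The edges whose enlarged
  piece lies within distance $r$ of their first vertex, and whose first vertex is the only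
  point of a given basic open set within distance $2r + 2$, have this property
  (\<open>isolated_scattered_edges\<close>).  Countably many choices of the parameters arise in this way, and
  since balls are finite, every uncovered vertex is covered by the extension belonging to one of them
  (\<open>extendable_extensions\<close>).

  Hence countably many Borel extensions of a Borel matching together cover the space, and by the Baire
  category theorem every nonempty open set has a nonempty open subset in which one of them covers
  comeagerly many points.  Let $h_0, h_1, \ldots$ be Borel functions that enumerate the component of
  every point.  Extending step by step, with one step for every basic open set and every $n$,
  yields a matching that covers $h_n(x)$ for comeagerly many $x$, for all $n$ simultaneously:
  \<open>generic_sequence\<close>.  The points whose whole component is covered form the required set.

  The functions $h_n$, which also turn every quantifier over a component into a countable union or
  intersection and so make all sets involved Borel, come from the Lusin-Novikov theorem for relations
  with finite sections, \<open>enumerable_if_finite_sections\<close>.  It rests on Novikov's separation theorem: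
  the analytic sets of points with at least $n$ points in their section have empty intersection, so they
  are contained in Borel sets with empty intersection.  Off each of these Borel sets the sections are
  bounded in size, and an induction on the bound finishes the argument.
\<close>

section \<open>Analytic sets\<close>

definition analytic :: "'x::topological_space set \<Rightarrow> bool" where
  "analytic A \<longleftrightarrow> (\<exists>C :: ('x \<times> (nat \<Rightarrow> nat)) set. closed C \<and> A = fst ` C)"

lemma analyticI:
  fixes C :: "('x::topological_space \<times> (nat \<Rightarrow> nat)) set"
  assumes "closed C" "\<And>x. x \<in> A \<longleftrightarrow> (\<exists>\<alpha>. (x, \<alpha>) \<in> C)"
  shows "analytic A"
  unfolding analytic_def using assms by (intro exI[of _ C]) force

lemma analyticE:
  fixes A :: "'x::topological_space set"
  assumes "analytic A"
  obtains C :: "('x \<times> (nat \<Rightarrow> nat)) set"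
    where "closed C" "\<And>x. x \<in> A \<longleftrightarrow> (\<exists>\<alpha>. (x, \<alpha>) \<in> C)"
  using assms unfolding analytic_def by force

lemma closed_vimage_continuous:
  assumes "closed C" "continuous_on UNIV f"
  shows "closed {x. f x \<in> C}"
  using closed_vimage[OF assms] by (simp add: vimage_def)

lemma closed_imp_analytic:
  assumes "closed A"
  shows "analytic A"
  by (rule analyticI[of "A \<times> UNIV"]) (use assms in \<open>auto intro!: closed_Times\<close>)

lemma continuous_on_snd_coordinate:
  "continuous_on UNIV (\<lambda>p :: 'x::topological_space \<times> (nat \<Rightarrow> nat). snd p i)"
  by (rule continuous_on_product_then_coordinatewise[of UNIV snd])
    (simp add: continuous_on_snd continuous_on_id)

lemma continuous_on_reindex:
  "continuous_on UNIV (\<lambda>p :: 'x::topological_space \<times> (nat \<Rightarrow> nat). (fst p, \<lambda>k. snd p (g k)))"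
  by (intro continuous_on_Pair continuous_on_coordinatewise_then_product
      continuous_on_snd_coordinate continuous_on_fst continuous_on_id)

text \<open>The first entry of a witness says which of the sets is meant.\<close>

lemma analytic_UN:
  fixes A :: "nat \<Rightarrow> 'x::topological_space set"
  assumes "\<And>n. analytic (A n)"
  shows "analytic (\<Union>n. A n)"
proof -
  have "\<exists>C :: ('x \<times> (nat \<Rightarrow> nat)) set. closed C \<and> (\<forall>x. x \<in> A n \<longleftrightarrow> (\<exists>\<alpha>. (x, \<alpha>) \<in> C))" for n
    using assms[of n] by (metis analyticE)
  then obtain C :: "nat \<Rightarrow> ('x \<times> (nat \<Rightarrow> nat)) set"
    where cl: "\<And>n. closed (C n)" and C: "\<And>n x. x \<in> A n \<longleftrightarrow> (\<exists>\<alpha>. (x, \<alpha>) \<in> C n)"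
    by metis
  define D where "D = {(x, \<alpha>). (x, \<lambda>k. \<alpha> (Suc k)) \<in> C (\<alpha> 0)}"
  have "open (- D)"
  proof -
    have "- D = (\<Union>n. {p. snd p 0 = n} \<inter> {p. (fst p, \<lambda>k. snd p (Suc k)) \<in> - C n})"
      by (auto simp: D_def)
    moreover have "open {p :: 'x \<times> (nat \<Rightarrow> nat). snd p 0 = n}" for n
    proof -
      show ?thesis
        using open_vimage[OF open_discrete continuous_on_snd_coordinate[of 0], of "{n}"]
        by (simp add: vimage_def)
    qed
    moreover have "open {p. (fst p, \<lambda>k. snd p (Suc k)) \<in> - C n}" for n
    proof -
      show ?thesis
        using open_vimage[OF _ continuous_on_reindex[of Suc], of "- C n"] cl[of n]
        by (simp add: vimage_def open_Compl)
    qed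
    ultimately show ?thesis by (auto intro!: open_UN open_Int)
  qed
  then show ?thesis
  proof (intro analyticI[of D])
    show "x \<in> (\<Union>n. A n) \<longleftrightarrow> (\<exists>\<alpha>. (x, \<alpha>) \<in> D)" for x
    proof
      assume "x \<in> (\<Union>n. A n)"
      then obtain n \<alpha> where "(x, \<alpha>) \<in> C n" using C by blast
      then have "(x, case_nat n \<alpha>) \<in> D" by (simp add: D_def)
      then show "\<exists>\<alpha>. (x, \<alpha>) \<in> D" by blast
    qed (use C in \<open>auto simp: D_def\<close>)
  qed (simp add: closed_def)
qed

text \<open>A single sequence of natural numbers codes a sequence of witnesses.\<close>

lemma analytic_INT:
  fixes A :: "nat \<Rightarrow> 'x::topological_space set"
  assumes "\<And>n. analytic (A n)"
  shows "analytic (\<Inter>n. A n)"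
proof -
  have "\<exists>C :: ('x \<times> (nat \<Rightarrow> nat)) set. closed C \<and> (\<forall>x. x \<in> A n \<longleftrightarrow> (\<exists>\<alpha>. (x, \<alpha>) \<in> C))" for n
    using assms[of n] by (metis analyticE)
  then obtain C :: "nat \<Rightarrow> ('x \<times> (nat \<Rightarrow> nat)) set"
    where cl: "\<And>n. closed (C n)" and C: "\<And>n x. x \<in> A n \<longleftrightarrow> (\<exists>\<alpha>. (x, \<alpha>) \<in> C n)"
    by metis
  define D where "D = (\<Inter>n. {p. (fst p, \<lambda>k. snd p (prod_encode (n, k))) \<in> C n})"
  have "closed D"
    unfolding D_def
    by (intro closed_INT ballI closed_vimage_continuous cl continuous_on_reindex)
  then show ?thesis
  proof (rule analyticI)
    show "x \<in> (\<Inter>n. A n) \<longleftrightarrow> (\<exists>\<alpha>. (x, \<alpha>) \<in> D)" for x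
    proof
      assume "x \<in> (\<Inter>n. A n)"
      then have "\<forall>n. \<exists>\<alpha>. (x, \<alpha>) \<in> C n" using C by blast
      then obtain \<alpha> where \<alpha>: "\<And>n. (x, \<alpha> n) \<in> C n" by metis
      then have "(x, \<lambda>m. \<alpha> (fst (prod_decode m)) (snd (prod_decode m))) \<in> D"
        by (simp add: D_def)
      then show "\<exists>\<alpha>. (x, \<alpha>) \<in> D" by blast
    qed (use C in \<open>auto simp: D_def\<close>)
  qed
qed

lemma analytic_Int:
  assumes "analytic A" "analytic B"
  shows "analytic (A \<inter> B)"
proof -
  have "A \<inter> B = (\<Inter>n::nat. if n = 0 then A else B)"
    by (auto split: if_splits)
  moreover have "analytic (if n = (0::nat) then A else B)" for n
    using assms by simp
  ultimately show ?thesis using analytic_INT by metis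
qed

lemma analytic_INT_less:
  fixes n :: nat
  assumes "\<And>i. i < n \<Longrightarrow> analytic (A i)"
  shows "analytic (\<Inter>i<n. A i)"
proof -
  have "(\<Inter>i<n. A i) = (\<Inter>i. if i < n then A i else UNIV)"
    by (rule set_eqI) (simp only: INT_iff lessThan_iff split: if_split, auto)
  moreover have "analytic (if i < n then A i else UNIV)" for i
    using assms by (simp add: closed_imp_analytic)
  then have "analytic (\<Inter>i. if i < n then A i else UNIV)"
    by (rule analytic_INT)
  ultimately show ?thesis by (simp only:)
qed

text \<open>The sets that are analytic together with their complement form a sigma-algebra; it contains the
  closed sets because an open set in a metric space is a countable union of closed sets.\<close>

lemma borel_imp_analytic:
  fixes A :: "'x::metric_space set"
  assumes "A \<in> sets borel"
  shows "analytic A"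
proof -
  have "A \<in> sigma_sets UNIV (Collect closed)"
    using assms by (simp add: borel_eq_closed)
  then have "analytic A \<and> analytic (- A)"
  proof induction
    case (Basic a)
    then have "closed a" by simp
    have "analytic (- a)"
    proof (cases "a = {}")
      case False
      have "- a = (\<Union>n. {x. inverse (real (Suc n)) \<le> infdist x a})"
      proof (intro set_eqI iffI)
        fix x assume "x \<in> - a"
        then have "0 < infdist x a"
          using \<open>closed a\<close> False in_closed_iff_infdist_zero[of a x] infdist_nonneg[of x a] by force
        then obtain n where "inverse (real (Suc n)) < infdist x a"
          using reals_Archimedean by blast
        then have "inverse (real (Suc n)) \<le> infdist x a" by (rule less_imp_le)
        then show "x \<in> (\<Union>n. {x. inverse (real (Suc n)) \<le> infdist x a})" by blast
      next
        fix x assume "x \<in> (\<Union>n. {x. inverse (real (Suc n)) \<le> infdist x a})"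
        then obtain n where "inverse (real (Suc n)) \<le> infdist x a" by blast
        then have "infdist x a \<noteq> 0"
          using inverse_positive_iff_positive[of "real (Suc n)"] by linarith
        then show "x \<in> - a" by auto
      qed
      moreover have "analytic (\<Union>n. {x. inverse (real (Suc n)) \<le> infdist x a})"
        by (intro analytic_UN closed_imp_analytic closed_Collect_le continuous_intros)
      ultimately show ?thesis by (simp only:)
    qed (simp add: closed_imp_analytic)
    then show ?case using \<open>closed a\<close> by (simp add: closed_imp_analytic)
  next
    case Empty
    show ?case by (auto intro: closed_imp_analytic)
  next
    case (Compl a)
    then show ?case by (simp add: Compl_eq_Diff_UNIV[symmetric])
  next
    case (Union a)
    have "- (\<Union>n. a n) = (\<Inter>n. - a n)" by auto
    then show ?case using Union analytic_UN[of a] analytic_INT[of "\<lambda>n. - a n"] by simp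
  qed
  then show ?thesis ..
qed


lemma continuous_on_coordinate:
  "continuous_on UNIV (\<lambda>\<alpha> :: nat \<Rightarrow> nat. \<alpha> i)"
  by (rule continuous_on_product_then_coordinatewise[of UNIV "\<lambda>\<alpha>. \<alpha>"]) (rule continuous_on_id)

lemma continuous_on_coordinate_fun:
  fixes d :: "nat \<Rightarrow> 'y::topological_space"
  shows "continuous_on A (\<lambda>\<alpha> :: nat \<Rightarrow> nat. d (\<alpha> i))"
  by (rule continuous_on_compose2[where t = UNIV and g = d])
    (auto intro: continuous_on_subset[OF continuous_on_coordinate])

lemma dense_sequence:
  obtains d :: "nat \<Rightarrow> 'y::{metric_space,second_countable_topology}"
  where "\<And>y e. 0 < e \<Longrightarrow> \<exists>n. dist (d n) y < e"
proof -
  obtain D :: "'y set" where D: "countable D" "\<And>X. open X \<Longrightarrow> X \<noteq> {} \<Longrightarrow> \<exists>d\<in>D. d \<in> X"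
    using countable_dense_exists by blast
  have "D \<noteq> {}" using D(2)[of UNIV] by auto
  have "\<exists>n. dist (from_nat_into D n) y < e" if "0 < e" for y e
  proof -
    have "\<exists>z\<in>D. z \<in> ball y e" using D(2)[of "ball y e"] that by auto
    then obtain z where "z \<in> D" "dist z y < e" by (auto simp: dist_commute)
    then show ?thesis using from_nat_into_surj[OF D(1)] by metis
  qed
  then show thesis by (rule that)
qed

lemma fast_LIMSEQ:
  fixes u :: "nat \<Rightarrow> 'y::metric_space"
  assumes "\<And>n. dist (u n) y \<le> (1/2)^n"
  shows "u \<longlonglongrightarrow> y"
proof (rule metric_tendsto_imp_tendsto)
  show "(\<lambda>n. (1/2::real)^n) \<longlonglongrightarrow> 0" by (rule LIMSEQ_power_zero) simp
  show "\<forall>\<^sub>F n in sequentially. dist (u n) y \<le> dist ((1/2::real)^n) 0"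
    using assms by simp
qed

lemma fast_Cauchy_limit:
  fixes u :: "nat \<Rightarrow> 'y::complete_space"
  assumes "\<And>m n. dist (u m) (u n) \<le> (1/2)^m + (1/2)^n"
  shows "\<exists>z. u \<longlonglongrightarrow> z \<and> (\<forall>m. dist (u m) z \<le> (1/2)^m)"
proof -
  have half: "(\<lambda>n. (1/2::real)^n) \<longlonglongrightarrow> 0" by (rule LIMSEQ_power_zero) simp
  have "Cauchy u"
  proof (rule metric_CauchyI)
    fix e :: real assume "0 < e"
    then obtain N where N: "\<And>n. n \<ge> N \<Longrightarrow> (1/2::real)^n < e/2"
      using order_tendstoD(2)[OF half, of "e/2"] by (auto simp: eventually_sequentially)
    have "dist (u m) (u n) < e" if "m \<ge> N" "n \<ge> N" for m n
      using assms[of m n] N[OF that(1)] N[OF that(2)] by linarith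
    then show "\<exists>M. \<forall>m\<ge>M. \<forall>n\<ge>M. dist (u m) (u n) < e" by blast
  qed
  then obtain z where z: "u \<longlonglongrightarrow> z" by (auto simp: Cauchy_convergent_iff convergent_def)
  have "dist (u m) z \<le> (1/2)^m" for m
  proof (rule LIMSEQ_le)
    show "(\<lambda>n. dist (u m) (u n)) \<longlonglongrightarrow> dist (u m) z"
      by (intro tendsto_intros z)
    show "(\<lambda>n. (1/2)^m + (1/2)^n) \<longlonglongrightarrow> (1/2::real)^m"
      using tendsto_add[OF tendsto_const half, of "(1/2)^m"] by simp
    show "\<exists>N. \<forall>n\<ge>N. dist (u m) (u n) \<le> (1/2)^m + (1/2)^n"
      using assms by simp
  qed
  then show ?thesis using z by blast
qed

text \<open>A point is coded by a sequence of indices into a dense sequence.  Membership in $K$ says that the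
  indexed points come together at a prescribed speed, which makes the convergence uniform in the code
  and hence the limit continuous.\<close>

lemma polish_continuous_image:
  obtains K :: "(nat \<Rightarrow> nat) set" and \<phi> :: "(nat \<Rightarrow> nat) \<Rightarrow> 'y::{complete_space,second_countable_topology}"
  where "closed K" "continuous_on K \<phi>" "\<phi> ` K = UNIV"
proof -
  obtain d :: "nat \<Rightarrow> 'y" where d: "\<And>y e. 0 < e \<Longrightarrow> \<exists>n. dist (d n) y < e"
    using dense_sequence by blast
  define K where "K = (\<Inter>m n. {\<alpha>. dist (d (\<alpha> m)) (d (\<alpha> n)) \<le> (1/2)^m + (1/2)^n})"
  have "closed K"
    unfolding K_def
    by (intro closed_INT ballI closed_Collect_le continuous_on_dist continuous_on_const
        continuous_on_coordinate_fun)
  have "\<exists>z. (\<lambda>n. d (\<alpha> n)) \<longlonglongrightarrow> z \<and> (\<forall>m. dist (d (\<alpha> m)) z \<le> (1/2)^m)" if "\<alpha> \<in> K" for \<alpha>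
    by (rule fast_Cauchy_limit) (use that in \<open>simp add: K_def\<close>)
  then obtain \<phi> where lim: "\<And>\<alpha>. \<alpha> \<in> K \<Longrightarrow> (\<lambda>n. d (\<alpha> n)) \<longlonglongrightarrow> \<phi> \<alpha>"
    and near: "\<And>\<alpha> m. \<alpha> \<in> K \<Longrightarrow> dist (d (\<alpha> m)) (\<phi> \<alpha>) \<le> (1/2)^m"
    by metis
  have half: "(\<lambda>n. (1/2::real)^n) \<longlonglongrightarrow> 0" by (rule LIMSEQ_power_zero) simp
  have "uniform_limit K (\<lambda>n \<alpha>. d (\<alpha> n)) \<phi> sequentially"
  proof (rule uniform_limitI)
    fix e :: real assume "0 < e"
    then have "\<forall>\<^sub>F n in sequentially. (1/2::real)^n < e"
      by (rule order_tendstoD(2)[OF half])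
    then show "\<forall>\<^sub>F n in sequentially. \<forall>\<alpha>\<in>K. dist (d (\<alpha> n)) (\<phi> \<alpha>) < e"
      by eventually_elim (use near in \<open>auto intro: le_less_trans\<close>)
  qed
  then have "continuous_on K \<phi>"
    by (rule uniform_limit_theorem[rotated])
      (auto intro!: always_eventually continuous_on_coordinate_fun)
  have "y \<in> \<phi> ` K" for y
  proof -
    have "\<forall>n. \<exists>i. dist (d i) y < (1/2)^n" using d by simp
    then obtain \<alpha> where \<alpha>: "\<And>n. dist (d (\<alpha> n)) y < (1/2)^n" by metis
    have "dist (d (\<alpha> m)) (d (\<alpha> n)) \<le> (1/2)^m + (1/2)^n" for m n
      using dist_triangle2[of "d (\<alpha> m)" "d (\<alpha> n)" y] \<alpha>[of m] \<alpha>[of n] by linarith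
    then have "\<alpha> \<in> K" by (simp add: K_def)
    have "(\<lambda>n. d (\<alpha> n)) \<longlonglongrightarrow> y"
      using \<alpha> by (intro fast_LIMSEQ less_imp_le)
    then have "\<phi> \<alpha> = y" using lim[OF \<open>\<alpha> \<in> K\<close>] LIMSEQ_unique by blast
    then show ?thesis using \<open>\<alpha> \<in> K\<close> by blast
  qed
  then show thesis using that \<open>closed K\<close> \<open>continuous_on K \<phi>\<close> by blast
qed

text \<open>A point of the second factor is replaced by one of its codes in Baire space.  The even entries of
  the new witness are this code, and the odd entries are the old witness.\<close>

lemma analytic_fst_image:
  fixes A :: "('x::topological_space \<times> 'y::{complete_space,second_countable_topology}) set"
  assumes "analytic A"
  shows "analytic (fst ` A)"
proof -
  obtain C :: "(('x \<times> 'y) \<times> (nat \<Rightarrow> nat)) set" where C: "closed C" "A = fst ` C"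
    using assms unfolding analytic_def by blast
  obtain K and \<phi> :: "(nat \<Rightarrow> nat) \<Rightarrow> 'y"
    where K: "closed K" "continuous_on K \<phi>" "\<phi> ` K = UNIV"
    using polish_continuous_image by blast
  define even_part where "even_part \<gamma> = (\<lambda>k. \<gamma> (2 * k))" for \<gamma> :: "nat \<Rightarrow> nat"
  define odd_part where "odd_part \<gamma> = (\<lambda>k. \<gamma> (2 * k + 1))" for \<gamma> :: "nat \<Rightarrow> nat"
  have parts:
    "continuous_on S (\<lambda>p :: 'x \<times> (nat \<Rightarrow> nat). even_part (snd p))"
    "continuous_on S (\<lambda>p :: 'x \<times> (nat \<Rightarrow> nat). odd_part (snd p))" for S
    unfolding even_part_def odd_part_def
    by (rule continuous_on_subset[OF _ subset_UNIV], rule continuous_on_coordinatewise_then_product,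
        rule continuous_on_snd_coordinate)+
  define L where "L = {p :: 'x \<times> (nat \<Rightarrow> nat). even_part (snd p) \<in> K}"
  have "closed L"
    unfolding L_def by (intro closed_vimage_continuous K parts)
  define \<psi> where "\<psi> p = ((fst p, \<phi> (even_part (snd p))), odd_part (snd p))"
    for p :: "'x \<times> (nat \<Rightarrow> nat)"
  have "continuous_on L \<psi>"
    unfolding \<psi>_def
    by (intro continuous_on_Pair continuous_on_compose2[OF K(2) parts(1)] parts(2)
        continuous_on_fst continuous_on_id) (auto simp: L_def)
  then have "closed (\<psi> -` C \<inter> L)"
    using \<open>closed L\<close> C(1) by (simp add: continuous_on_closed_vimage)
  then show ?thesis
  proof (rule analyticI)
    fix x
    show "x \<in> fst ` A \<longleftrightarrow> (\<exists>\<alpha>. (x, \<alpha>) \<in> \<psi> -` C \<inter> L)"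
    proof
      assume "x \<in> fst ` A"
      then obtain y \<beta> where "((x, y), \<beta>) \<in> C" using C(2) by auto
      moreover obtain \<alpha> where "\<alpha> \<in> K" "\<phi> \<alpha> = y" using K(3) by (metis UNIV_I imageE)
      moreover define \<gamma> where "\<gamma> n = (if even n then \<alpha> (n div 2) else \<beta> (n div 2))" for n
      moreover have "even_part \<gamma> = \<alpha>" "odd_part \<gamma> = \<beta>"
        by (auto simp: even_part_def odd_part_def \<gamma>_def)
      ultimately have "(x, \<gamma>) \<in> \<psi> -` C \<inter> L" by (simp add: \<psi>_def L_def)
      then show "\<exists>\<alpha>. (x, \<alpha>) \<in> \<psi> -` C \<inter> L" by blast
    next
      assume "\<exists>\<alpha>. (x, \<alpha>) \<in> \<psi> -` C \<inter> L"
      then obtain \<gamma> where "((x, \<phi> (even_part \<gamma>)), odd_part \<gamma>) \<in> C" by (auto simp: \<psi>_def)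
      then show "x \<in> fst ` A" unfolding C(2) image_image by force
    qed
  qed
qed

section \<open>Separation of analytic sets by Borel sets\<close>

lemma tendsto_eventually_eq_coordinates:
  fixes \<alpha> :: "'i \<Rightarrow> nat \<Rightarrow> nat"
  assumes "\<And>k. \<forall>\<^sub>F t in F. \<alpha> t k = y k"
  shows "(\<alpha> \<longlongrightarrow> y) F"
proof -
  have "limitin (product_topology (\<lambda>_. euclidean) UNIV) \<alpha> y F"
    unfolding limitin_componentwise
    using assms by (auto intro: tendsto_eventually simp: euclidean_product_topology)
  then show ?thesis by (simp add: euclidean_product_topology)
qed

definition borel_separated :: "(nat \<Rightarrow> 'x::topological_space set) \<Rightarrow> bool" where
  "borel_separated A \<longleftrightarrow> (\<exists>B. (\<forall>n. B n \<in> sets borel \<and> A n \<subseteq> B n) \<and> (\<Inter>n. B n) = {})"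

text \<open>Given Borel sets for each of the families with \<open>D i\<close> in place of \<open>A m\<close>, take their union at
  index \<open>m\<close> and their intersection at all other indices.\<close>

lemma borel_separated_split:
  assumes "A m \<subseteq> (\<Union>i::nat. D i)" "\<And>i. borel_separated (A(m := D i))"
  shows "borel_separated A"
proof -
  have "\<forall>i. \<exists>B. (\<forall>n. B n \<in> sets borel \<and> (A(m := D i)) n \<subseteq> B n) \<and> (\<Inter>n. B n) = {}"
    using assms(2) unfolding borel_separated_def by blast
  then obtain B where B: "\<And>i n. B i n \<in> sets borel" "\<And>i n. (A(m := D i)) n \<subseteq> B i n"
    "\<And>i. (\<Inter>n. B i n) = {}"
    by metis
  define B' where "B' n = (if n = m then \<Union>i. B i m else \<Inter>i. B i n)" for n
  have "B' n \<in> sets borel" for n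
    unfolding B'_def using B(1) by auto
  moreover have "A n \<subseteq> B' n" for n
  proof (cases "n = m")
    case True
    have "D i \<subseteq> B i m" for i using B(2)[of i m] by simp
    then show ?thesis using assms(1) True by (force simp: B'_def)
  next
    case False
    then have "A n \<subseteq> B i n" for i using B(2)[of i n] by simp
    then show ?thesis using False by (auto simp: B'_def)
  qed
  moreover have "(\<Inter>n. B' n) = {}"
  proof (rule equals0I)
    fix x assume x: "x \<in> (\<Inter>n. B' n)"
    then have "x \<in> B' m" by blast
    then obtain i where i: "x \<in> B i m" by (auto simp: B'_def)
    have "x \<in> B i n" for n
    proof (cases "n = m")
      case False
      have "x \<in> B' n" using x by blast
      then show ?thesis using False by (simp add: B'_def)
    qed (use i in simp)
    then show False using B(3)[of i] by blast
  qed
  ultimately show ?thesis unfolding borel_separated_def by blast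
qed

text \<open>If the family is not separated, then by \<open>borel_separated_split\<close> the sets can be cut down, one at a
  time and infinitely often each, to the points having a witness with a given longer initial segment,
  without the family becoming separated.  The whole space, added as the set with index \<open>0\<close>, is
  cut down to smaller and smaller intersections of closed balls.  Such an intersection must meet all
  the other sets, since otherwise it and its complement would separate two of them.  In the limit
  the balls determine a point and the initial segments a witness that it lies in each \<open>A n\<close>.\<close>

theorem novikov_separation:
  fixes A :: "nat \<Rightarrow> 'x::polish_space set"
  assumes "\<And>n. analytic (A n)" "(\<Inter>n. A n) = {}"
  shows "borel_separated A"
proof (rule ccontr)
  assume not_sep: "\<not> borel_separated A"
  have "\<forall>n. \<exists>C :: ('x \<times> (nat \<Rightarrow> nat)) set. closed C \<and> A n = fst ` C"
    using assms(1) unfolding analytic_def by blast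
  then obtain C :: "nat \<Rightarrow> ('x \<times> (nat \<Rightarrow> nat)) set" where
    C: "\<And>n. closed (C n)" "\<And>n. A n = fst ` C n"
    by metis
  obtain d :: "nat \<Rightarrow> 'x" where d: "\<And>y e. 0 < e \<Longrightarrow> \<exists>n. dist (d n) y < e"
    using dense_sequence by blast
  define F where "F n s = (case n of
      0 \<Rightarrow> {x. \<forall>j<length s. dist (d (s ! j)) x \<le> (1/2)^j}
    | Suc n \<Rightarrow> {x. \<exists>\<alpha>. (\<forall>j<length s. \<alpha> j = s ! j) \<and> (x, \<alpha>) \<in> C n})" for n and s :: "nat list"
  have F_0: "x \<in> F 0 s \<longleftrightarrow> (\<forall>j<length s. dist (d (s ! j)) x \<le> (1/2)^j)" for x s
    by (simp add: F_def)
  have F_Suc: "x \<in> F (Suc n) s \<longleftrightarrow> (\<exists>\<alpha>. (\<forall>j<length s. \<alpha> j = s ! j) \<and> (x, \<alpha>) \<in> C n)" for x n s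
    by (simp add: F_def)
  have split: "F n s \<subseteq> (\<Union>i. F n (s @ [i]))" for n s
  proof
    fix x assume x: "x \<in> F n s"
    show "x \<in> (\<Union>i. F n (s @ [i]))"
    proof (cases n)
      case 0
      obtain i where "dist (d i) x < (1/2)^length s" using d[of "(1/2)^length s" x] by auto
      then have "x \<in> F n (s @ [i])"
        using x 0 by (auto simp: F_0 nth_append less_Suc_eq)
      then show ?thesis by blast
    next
      case (Suc m)
      then obtain \<alpha> where "\<forall>j<length s. \<alpha> j = s ! j" "(x, \<alpha>) \<in> C m"
        using x by (auto simp: F_Suc)
      then have "x \<in> F n (s @ [\<alpha> (length s)])"
        using Suc by (auto simp: F_Suc nth_append less_Suc_eq)
      then show ?thesis by blast
    qed
  qed
  have init: "\<not> borel_separated (\<lambda>n. F n [])"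
  proof
    assume "borel_separated (\<lambda>n. F n [])"
    then obtain B where B: "\<And>n. B n \<in> sets borel" "\<And>n. F n [] \<subseteq> B n" "(\<Inter>n. B n) = {}"
      unfolding borel_separated_def by blast
    have "A n \<subseteq> B (Suc n)" for n using B(2)[of "Suc n"] C(2)[of n] by (force simp: F_def)
    moreover have "(\<Inter>n. B (Suc n)) = {}"
    proof (rule equals0I)
      fix x assume x: "x \<in> (\<Inter>n. B (Suc n))"
      have "x \<in> B n" for n
      proof (cases n)
        case 0
        then show ?thesis using B(2)[of 0] by (auto simp: F_def)
      qed (use x in auto)
      then show False using B(3) by blast
    qed
    ultimately have "borel_separated A"
      using B(1) unfolding borel_separated_def by (intro exI[of _ "\<lambda>n. B (Suc n)"]) blast
    then show False using not_sep by blast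
  qed
  have extend: "\<exists>S'. \<not> borel_separated (\<lambda>n. F n (S' n)) \<and> (\<exists>i. S' = S(m := S m @ [i]))"
    if "\<not> borel_separated (\<lambda>n. F n (S n))" for S m
  proof -
    have upd: "(\<lambda>n. F n (S n))(m := F m (S m @ [i])) = (\<lambda>n. F n ((S(m := S m @ [i])) n))" for i
      by (rule ext) simp
    have "\<exists>i. \<not> borel_separated ((\<lambda>n. F n (S n))(m := F m (S m @ [i])))"
      using borel_separated_split[of "\<lambda>n. F n (S n)" m "\<lambda>i. F m (S m @ [i])"] split[of m "S m"] that
      by blast
    then show ?thesis unfolding upd by blast
  qed
  have "\<exists>S. \<forall>t. \<not> borel_separated (\<lambda>n. F n (S t n)) \<and>
      (\<exists>i. S (Suc t) = (S t)(fst (prod_decode t) := S t (fst (prod_decode t)) @ [i]))"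
  proof (rule dependent_nat_choice)
    show "\<exists>S. \<not> borel_separated (\<lambda>n. F n (S n))"
      using init by (intro exI[of _ "\<lambda>_. []"])
  qed (rule extend)
  then obtain S where S: "\<And>t. \<not> borel_separated (\<lambda>n. F n (S t n))"
    "\<And>t. \<exists>i. S (Suc t) = (S t)(fst (prod_decode t) := S t (fst (prod_decode t)) @ [i])"
    by blast
  have prefix: "\<exists>zs. S t' n = S t n @ zs" if "t \<le> t'" for t t' n
    using that
  proof (induction rule: dec_induct)
    case (step t')
    then obtain zs where "S t' n = S t n @ zs" by blast
    then show ?case using S(2)[of t'] by (cases "n = fst (prod_decode t')") force+
  qed simp
  have long: "\<exists>t. k \<le> length (S t n)" for k n
  proof (induction k)
    case (Suc k)
    then obtain t where t: "k \<le> length (S t n)" by blast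
    define t' where "t' = prod_encode (n, t)"
    have "k \<le> length (S t' n)"
      using prefix[of t t' n] t le_prod_encode_2[of t n] by (auto simp: t'_def)
    then have "Suc k \<le> length (S (Suc t') n)"
      using S(2)[of t'] by (auto simp: t'_def)
    then show ?case by blast
  qed simp
  then have "\<forall>n k. \<exists>t. Suc k \<le> length (S t n)" by blast
  then obtain \<tau> where \<tau>: "\<And>n k. Suc k \<le> length (S (\<tau> n k) n)" by metis
  define y where "y n k = S (\<tau> n k) n ! k" for n k
  have y: "S t n ! k = y n k" if "k < length (S t n)" for t n k
  proof (cases "t \<le> \<tau> n k")
    case True
    then obtain zs where "S (\<tau> n k) n = S t n @ zs" using prefix by blast
    then show ?thesis using that by (simp add: y_def nth_append)
  next
    case False
    then obtain zs where "S t n = S (\<tau> n k) n @ zs" using prefix[of "\<tau> n k" t n] by auto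
    then show ?thesis using \<tau>[of k n] by (simp add: y_def nth_append)
  qed
  have length_mono: "Suc k \<le> length (S t n)" if "\<tau> n k \<le> t" for n k t
    using prefix[OF that, of n] \<tau>[of k n] by auto
  have meets: "F (Suc n) (S t (Suc n)) \<inter> F 0 (S t 0) \<noteq> {}" for n t
  proof
    assume empty: "F (Suc n) (S t (Suc n)) \<inter> F 0 (S t 0) = {}"
    have "F 0 (S t 0) = (\<Inter>j<length (S t 0). {x. dist (d (S t 0 ! j)) x \<le> (1/2)^j})"
      by (auto simp: F_0)
    also have "closed \<dots>"
      by (intro closed_INT ballI closed_Collect_le continuous_intros)
    finally have "F 0 (S t 0) \<in> sets borel" by (rule borel_closed)
    moreover define B where
      "B m = (if m = 0 then F 0 (S t 0) else if m = Suc n then - F 0 (S t 0) else UNIV)" for m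
    ultimately have "B m \<in> sets borel" "F m (S t m) \<subseteq> B m" for m
      using empty by (auto simp: B_def)
    moreover have "(\<Inter>m. B m) = {}"
    proof (rule equals0I)
      fix x assume x: "x \<in> (\<Inter>m. B m)"
      then have "x \<in> B 0" "x \<in> B (Suc n)" by blast+
      then show False by (simp add: B_def)
    qed
    ultimately show False using S(1)[of t] unfolding borel_separated_def by blast
  qed
  have "\<exists>z. (\<lambda>k. d (y 0 k)) \<longlonglongrightarrow> z \<and> (\<forall>k. dist (d (y 0 k)) z \<le> (1/2)^k)"
  proof (rule fast_Cauchy_limit)
    fix k l
    define t where "t = max (\<tau> 0 k) (\<tau> 0 l)"
    obtain x where "x \<in> F 0 (S t 0)" using meets[of 0 t] by blast
    moreover have "k < length (S t 0)" "l < length (S t 0)"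
      using length_mono[of 0 k t] length_mono[of 0 l t] by (auto simp: t_def)
    ultimately have "dist (d (y 0 k)) x \<le> (1/2)^k" "dist (d (y 0 l)) x \<le> (1/2)^l"
      using y by (auto simp: F_0)
    then show "dist (d (y 0 k)) (d (y 0 l)) \<le> (1/2)^k + (1/2)^l"
      using dist_triangle2[of "d (y 0 k)" "d (y 0 l)" x] by linarith
  qed
  then obtain z where z: "\<And>k. dist (d (y 0 k)) z \<le> (1/2)^k" by blast
  have "z \<in> A n" for n
  proof -
    have "\<forall>t. \<exists>p \<alpha>. p \<in> F 0 (S t 0) \<and> (p, \<alpha>) \<in> C n \<and> (\<forall>j<length (S t (Suc n)). \<alpha> j = S t (Suc n) ! j)"
      using meets[of n] by (fastforce simp: F_Suc)
    then obtain p \<alpha> where p: "\<And>t. p t \<in> F 0 (S t 0)" "\<And>t. (p t, \<alpha> t) \<in> C n"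
      and \<alpha>: "\<And>t j. j < length (S t (Suc n)) \<Longrightarrow> \<alpha> t j = S t (Suc n) ! j"
      by metis
    have "p \<longlonglongrightarrow> z"
    proof (rule metric_LIMSEQ_I)
      fix e :: real assume "0 < e"
      moreover have "(\<lambda>k. (1/2::real)^k) \<longlonglongrightarrow> 0" by (rule LIMSEQ_power_zero) simp
      ultimately have "\<forall>\<^sub>F k in sequentially. (1/2::real)^k < e / 2"
        by (intro order_tendstoD(2)) auto
      then obtain k where k: "(1/2::real)^k < e/2" by (auto simp: eventually_sequentially)
      have "dist (p t) z < e" if "\<tau> 0 k \<le> t" for t
      proof -
        have "k < length (S t 0)" using length_mono[OF that] by simp
        then have "dist (d (y 0 k)) (p t) \<le> (1/2)^k" using p(1)[of t] y by (auto simp: F_0)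
        then show ?thesis
          using z[of k] k dist_triangle3[of "p t" z "d (y 0 k)"] by linarith
      qed
      then show "\<exists>t0. \<forall>t\<ge>t0. dist (p t) z < e" by blast
    qed
    moreover have "\<alpha> \<longlonglongrightarrow> y (Suc n)"
    proof (rule tendsto_eventually_eq_coordinates)
      fix k
      have "\<alpha> t k = y (Suc n) k" if "\<tau> (Suc n) k \<le> t" for t
        using length_mono[OF that] \<alpha>[of k t] y[of k t "Suc n"] by simp
      then show "\<forall>\<^sub>F t in sequentially. \<alpha> t k = y (Suc n) k"
        unfolding eventually_sequentially by blast
    qed
    ultimately have "(\<lambda>t. (p t, \<alpha> t)) \<longlonglongrightarrow> (z, y (Suc n))" by (rule tendsto_Pair)
    then have "(z, y (Suc n)) \<in> C n"
      using closed_sequentially[OF C(1)[of n], of "\<lambda>t. (p t, \<alpha> t)"] p(2) by blast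
    then show ?thesis unfolding C(2) by force
  qed
  then show False using assms(2) by blast
qed

lemma lusin_separation:
  fixes A B :: "'x::polish_space set"
  assumes "analytic A" "analytic B" "A \<inter> B = {}"
  obtains S where "S \<in> sets borel" "A \<subseteq> S" "S \<inter> B = {}"
proof -
  have "borel_separated (\<lambda>n. if n = 0 then A else B)"
  proof (rule novikov_separation)
    show "(\<Inter>n::nat. if n = 0 then A else B) = {}"
    proof (rule equals0I)
      fix x assume x: "x \<in> (\<Inter>n::nat. if n = 0 then A else B)"
      have "x \<in> (if (0::nat) = 0 then A else B)" "x \<in> (if (1::nat) = 0 then A else B)"
        by (rule INT_D[OF x], rule UNIV_I)+
      then show False using assms(3) by auto
    qed
  qed (simp add: assms(1,2))
  then obtain C where C: "\<And>n::nat. C n \<in> sets borel" "\<And>n. (if n = 0 then A else B) \<subseteq> C n"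
    "(\<Inter>n. C n) = {}"
    unfolding borel_separated_def by blast
  define D where "D = (\<Inter>n. C (Suc n))"
  have "A \<subseteq> - D"
  proof
    fix x assume "x \<in> A"
    then have "x \<in> C 0" using C(2)[of 0] by auto
    show "x \<in> - D"
    proof
      assume "x \<in> D"
      then have "x \<in> C n" for n using \<open>x \<in> C 0\<close> by (cases n) (auto simp: D_def)
      then show False using C(3) by blast
    qed
  qed
  moreover have "B \<subseteq> D" using C(2)[of "Suc _"] by (auto simp: D_def)
  moreover have "- D \<in> sets borel" using C(1) by (auto simp: D_def)
  ultimately show thesis using that by blast
qed

section \<open>Borel relations with finite sections\<close>

lemma analytic_projection:
  fixes R :: "('x::polish_space \<times> 'y::polish_space) set"
  assumes "R \<in> sets borel" "V \<in> sets borel"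
  shows "analytic {x. \<exists>y\<in>V. (x, y) \<in> R}"
proof -
  have "snd -` V \<in> sets (borel :: ('x \<times> 'y) measure)"
    using measurable_sets[OF borel_measurable_continuous_onI[OF continuous_on_snd[OF continuous_on_id]] assms(2)]
    by simp
  then have "analytic (fst ` (R \<inter> snd -` V))"
    using assms(1) by (intro analytic_fst_image borel_imp_analytic sets.Int)
  moreover have "fst ` (R \<inter> snd -` V) = {x. \<exists>y\<in>V. (x, y) \<in> R}" by force
  ultimately show ?thesis by simp
qed

text \<open>For every small ball, the points of \<open>A\<close> whose value lies in the ball and those whose value does not
  are disjoint analytic sets.  Borel sets that separate them determine the value up to a small
  error, and do so in a Borel way even though \<open>A\<close> itself need not be Borel.\<close>

lemma single_valued_borel_extension:
  fixes R :: "('x::polish_space \<times> 'y::polish_space) set"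
  assumes "R \<in> sets borel" "analytic A"
    and single: "\<And>x y y'. x \<in> A \<Longrightarrow> (x, y) \<in> R \<Longrightarrow> (x, y') \<in> R \<Longrightarrow> y = y'"
  shows "\<exists>g. g \<in> borel_measurable borel \<and> (\<forall>x\<in>A. \<forall>y. (x, y) \<in> R \<longrightarrow> y = g x)"
proof -
  obtain d :: "nat \<Rightarrow> 'y" where d: "\<And>y e. 0 < e \<Longrightarrow> \<exists>n. dist (d n) y < e"
    using dense_sequence by blast
  define separates where "separates n i T \<longleftrightarrow>
      T \<in> sets borel \<and> (\<forall>x\<in>A. \<forall>y. (x, y) \<in> R \<longrightarrow> (x \<in> T \<longleftrightarrow> dist (d i) y < (1/2)^n))" for n i T
  have "\<exists>T. separates n i T" for n i
  proof -
    define V where "V = ball (d i) ((1/2)^n)"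
    have V: "V \<in> sets borel" by (simp add: V_def)
    have an: "analytic (A \<inter> {x. \<exists>y\<in>V. (x, y) \<in> R})" "analytic (A \<inter> {x. \<exists>y\<in>- V. (x, y) \<in> R})"
      using V assms(1,2) by (auto intro!: analytic_Int analytic_projection)
    have disj: "(A \<inter> {x. \<exists>y\<in>V. (x, y) \<in> R}) \<inter> (A \<inter> {x. \<exists>y\<in>- V. (x, y) \<in> R}) = {}"
      using single by blast
    obtain T where "T \<in> sets borel" "A \<inter> {x. \<exists>y\<in>V. (x, y) \<in> R} \<subseteq> T"
      "T \<inter> (A \<inter> {x. \<exists>y\<in>- V. (x, y) \<in> R}) = {}"
      by (rule lusin_separation[OF an disj])
    then have "T \<in> sets borel \<and> (\<forall>x\<in>A. \<forall>y. (x, y) \<in> R \<longrightarrow> (x \<in> T \<longleftrightarrow> y \<in> V))" by blast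
    then show ?thesis unfolding V_def mem_ball separates_def by blast
  qed
  then obtain T where "\<And>n i. separates n i (T n i)" by metis
  then have T: "\<And>n i. T n i \<in> sets borel"
    "\<And>n i x y. x \<in> A \<Longrightarrow> (x, y) \<in> R \<Longrightarrow> x \<in> T n i \<longleftrightarrow> dist (d i) y < (1/2)^n"
    unfolding separates_def by blast+
  define u where "u n x = d (LEAST i. x \<in> T n i)" for n x
  have [measurable]: "u n \<in> borel_measurable borel" for n
  proof -
    have "(\<lambda>x. LEAST i. x \<in> T n i) \<in> measurable borel (count_space UNIV)"
      using T(1) by (intro measurable_Least) (simp add: pred_def)
    then show ?thesis
      unfolding u_def by (rule measurable_compose) simp
  qed
  define v where "v n x = (if Cauchy (\<lambda>n. u n x) then u n x else d 0)" for n x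
  define g where "g x = (if Cauchy (\<lambda>n. u n x) then lim (\<lambda>n. u n x) else d 0)" for x
  have "g \<in> borel_measurable borel"
  proof (rule borel_measurable_LIMSEQ_metric)
    have "{x \<in> space borel. Cauchy (\<lambda>n. u n x)} \<in> sets borel"
      by (rule sets_Collect_Cauchy) simp
    then have "Measurable.pred borel (\<lambda>x. Cauchy (\<lambda>n. u n x))"
      by (simp add: pred_def)
    then show "v n \<in> borel_measurable borel" for n
      unfolding v_def by measurable
    show "(\<lambda>n. v n x) \<longlonglongrightarrow> g x" for x
      by (simp add: v_def g_def Cauchy_convergent_iff convergent_LIMSEQ_iff)
  qed
  moreover have "y = g x" if "x \<in> A" "(x, y) \<in> R" for x y
  proof -
    have "dist (u n x) y < (1/2)^n" for n
    proof -
      obtain i where "dist (d i) y < (1/2)^n" using d[of "(1/2)^n" y] by auto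
      then have "\<exists>i. x \<in> T n i" using T(2)[OF that, of n i] by blast
      then have "x \<in> T n (LEAST i. x \<in> T n i)" by (rule LeastI_ex)
      then show ?thesis using T(2)[OF that, of n "LEAST i. x \<in> T n i"] by (simp add: u_def)
    qed
    then have "(\<lambda>n. u n x) \<longlonglongrightarrow> y"
      by (intro fast_LIMSEQ less_imp_le)
    then have "Cauchy (\<lambda>n. u n x)" "lim (\<lambda>n. u n x) = y"
      by (rule LIMSEQ_imp_Cauchy, rule limI)
    then show ?thesis by (simp add: g_def)
  qed
  ultimately show ?thesis by blast
qed

text \<open>The functions are total, and their graphs may leave \<open>R\<close>.  For Borel \<open>R\<close> the surplus does no harm,
  because the set of all $x$ with \<open>(x, g n x) \<in> R\<close> is Borel.\<close>

definition borel_enumerable :: "('x::topological_space \<times> 'y::topological_space) set \<Rightarrow> bool" where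
  "borel_enumerable R \<longleftrightarrow>
    (\<exists>g :: nat \<Rightarrow> 'x \<Rightarrow> 'y. (\<forall>n. g n \<in> borel_measurable borel) \<and> (\<forall>x y. (x, y) \<in> R \<longrightarrow> (\<exists>n. y = g n x)))"

lemma borel_enumerableI:
  fixes g :: "'i::countable \<Rightarrow> 'x::topological_space \<Rightarrow> 'y::topological_space"
  assumes "\<And>i. g i \<in> borel_measurable borel" "\<And>x y. (x, y) \<in> R \<Longrightarrow> \<exists>i. y = g i x"
  shows "borel_enumerable R"
  unfolding borel_enumerable_def
proof (intro exI[of _ "\<lambda>n. g (from_nat n)"] conjI allI impI)
  fix x y assume "(x, y) \<in> R"
  then obtain i where "y = g i x" using assms(2) by blast
  then have "y = g (from_nat (to_nat i)) x" by simp
  then show "\<exists>n. y = g (from_nat n) x" by blast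
qed (rule assms(1))

lemma borel_enumerable_subset:
  "borel_enumerable R \<Longrightarrow> S \<subseteq> R \<Longrightarrow> borel_enumerable S"
  unfolding borel_enumerable_def by blast

lemma borel_enumerable_UN:
  fixes R :: "'i::countable \<Rightarrow> ('x::topological_space \<times> 'y::topological_space) set"
  assumes "\<And>i. borel_enumerable (R i)"
  shows "borel_enumerable (\<Union>i. R i)"
proof -
  have "\<forall>i. \<exists>g :: nat \<Rightarrow> 'x \<Rightarrow> 'y. (\<forall>n. g n \<in> borel_measurable borel) \<and>
      (\<forall>x y. (x, y) \<in> R i \<longrightarrow> (\<exists>n. y = g n x))"
    using assms unfolding borel_enumerable_def by blast
  then obtain g :: "'i \<Rightarrow> nat \<Rightarrow> 'x \<Rightarrow> 'y"
    where g: "\<And>i n. g i n \<in> borel_measurable borel" "\<And>i x y. (x, y) \<in> R i \<Longrightarrow> \<exists>n. y = g i n x"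
    by metis
  show ?thesis
  proof (rule borel_enumerableI[of "\<lambda>(i, n). g i n"])
    show "(case p of (i, n) \<Rightarrow> g i n) \<in> borel_measurable borel" for p
      using g(1) by (cases p) simp
    fix x y assume "(x, y) \<in> (\<Union>i. R i)"
    then obtain i n where "y = g i n x" using g(2) by blast
    then show "\<exists>p. y = (case p of (i, n) \<Rightarrow> g i n) x" by (intro exI[of _ "(i, n)"]) simp
  qed
qed

lemma borel_enumerable_Un:
  assumes "borel_enumerable R" "borel_enumerable S"
  shows "borel_enumerable (R \<union> S)"
proof -
  have "borel_enumerable (\<Union>b. if b then R else S)"
    by (rule borel_enumerable_UN) (simp add: assms)
  then show ?thesis by (simp add: UNIV_bool Un_commute)
qed

definition disjoint_up_to :: "nat \<Rightarrow> (nat \<Rightarrow> 'y set) \<Rightarrow> bool" where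
  "disjoint_up_to n V \<longleftrightarrow> (\<forall>i<n. \<forall>j<n. i \<noteq> j \<longrightarrow> V i \<inter> V j = {})"

text \<open>A row of the matrix assigns a ball of a common radius to each position of a list of centres, all of
  them taken from a dense sequence; so countably many rows separate the points of every finite list.\<close>

lemma separating_open_tuples:
  obtains V :: "nat \<Rightarrow> nat \<Rightarrow> 'y::{metric_space,second_countable_topology} set"
  where "\<And>c i. open (V c i)"
    and "\<And>ys. distinct ys \<Longrightarrow>
      \<exists>c. disjoint_up_to (length ys) (V c) \<and> (\<forall>i<length ys. ys ! i \<in> V c i)"
proof -
  obtain d :: "nat \<Rightarrow> 'y" where d: "\<And>y e. 0 < e \<Longrightarrow> \<exists>n. dist (d n) y < e"
    using dense_sequence by blast
  define W where "W m ks i = ball (d (ks ! i)) ((1/2)^m)" for m i and ks :: "nat list"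
  have W: "\<exists>m ks. disjoint_up_to (length ys) (W m ks) \<and> (\<forall>i<length ys. ys ! i \<in> W m ks i)"
    if "distinct ys" for ys
  proof -
    define E where "E = insert 1 ((\<lambda>(x, y). dist x y) ` {p \<in> set ys \<times> set ys. fst p \<noteq> snd p})"
    have "finite E" "\<forall>e\<in>E. 0 < e" by (auto simp: E_def)
    then have "0 < Min E" by (auto simp: E_def)
    then obtain m where m: "(1/2::real)^m < Min E / 4"
      using real_arch_pow_inv[of "Min E / 4" "1/2"] by auto
    have "\<forall>y. \<exists>k. dist (d k) y < (1/2)^m" using d by simp
    then obtain k where k: "\<And>y. dist (d (k y)) y < (1/2)^m" by metis
    have "W m (map k ys) i \<inter> W m (map k ys) j = {}"
      if ij: "i < length ys" "j < length ys" "i \<noteq> j" for i j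
    proof (rule equals0I)
      fix p assume "p \<in> W m (map k ys) i \<inter> W m (map k ys) j"
      then have "dist (d (k (ys ! i))) p < (1/2)^m" "dist (d (k (ys ! j))) p < (1/2)^m"
        using ij by (auto simp: W_def)
      then have "dist (ys ! i) p < 2 * (1/2)^m" "dist (ys ! j) p < 2 * (1/2)^m"
        using dist_triangle3[of "ys ! i" p "d (k (ys ! i))"] k[of "ys ! i"]
          dist_triangle3[of "ys ! j" p "d (k (ys ! j))"] k[of "ys ! j"] by linarith+
      then have "dist (ys ! i) (ys ! j) < Min E"
        using dist_triangle2[of "ys ! i" "ys ! j" p] m by linarith
      moreover have "dist (ys ! i) (ys ! j) \<in> E"
        using ij \<open>distinct ys\<close> by (force simp: E_def nth_eq_iff_index_eq)
      ultimately show False using Min_le[OF \<open>finite E\<close>] by fastforce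
    qed
    moreover have "ys ! i \<in> W m (map k ys) i" if "i < length ys" for i
      using that k by (simp add: W_def)
    ultimately show ?thesis unfolding disjoint_up_to_def by blast
  qed
  define V where "V c = (case from_nat c of (m, ks) \<Rightarrow> W m ks)" for c
  have V: "V (to_nat (m, ks)) = W m ks" for m ks by (simp add: V_def)
  show thesis
  proof (rule that[of V])
    show "open (V c i)" for c i by (auto simp: V_def W_def split: prod.split)
    show "\<exists>c. disjoint_up_to (length ys) (V c) \<and> (\<forall>i<length ys. ys ! i \<in> V c i)"
      if "distinct ys" for ys
      using W[OF that] V by metis
  qed
qed

lemma card_ge_disjoint_hits:
  assumes "finite S" "disjoint_up_to n V" "\<And>i. i < n \<Longrightarrow> S \<inter> V i \<noteq> {}"
  shows "n \<le> card S"
proof -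
  have "n = (\<Sum>i<n. 1)" by simp
  also have "\<dots> \<le> (\<Sum>i<n. card (S \<inter> V i))"
    using assms(1,3) by (intro sum_mono) (simp add: Suc_le_eq card_gt_0_iff)
  also have "\<dots> = card (\<Union>i<n. S \<inter> V i)"
    using assms(1,2) by (intro card_UN_disjoint[symmetric]) (auto simp: disjoint_up_to_def)
  also have "\<dots> \<le> card S" using assms(1) by (intro card_mono) auto
  finally show ?thesis .
qed

text \<open>If a section of the largest permitted size meets as many disjoint open sets as it has elements, then each
  of them contains exactly one element.  Hence the elements are values of Borel functions by
  \<open>single_valued_borel_extension\<close>.  The set \<open>D c\<close> of points where the functions
  actually produce such a tuple is Borel, and outside these sets the bound on the sections drops.\<close>

lemma enumerable_if_bounded_sections:
  fixes R :: "('x::polish_space \<times> 'y::polish_space) set"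
  assumes "R \<in> sets borel" "\<And>x. finite (R `` {x}) \<and> card (R `` {x}) \<le> N"
  shows "borel_enumerable R"
  using assms
proof (induction N arbitrary: R)
  case 0
  then have "R `` {x} = {}" for x using card_0_eq by blast
  then have "R = {}" by auto
  then show ?case by (auto intro: borel_enumerableI[of "\<lambda>(n::nat) x. undefined"])
next
  case (Suc N)
  note R[measurable] = Suc.prems(1)
  have fin: "finite (R `` {x})" and le: "card (R `` {x}) \<le> Suc N" for x
    using Suc.prems(2) by auto
  obtain V :: "nat \<Rightarrow> nat \<Rightarrow> 'y set" where V: "\<And>c i. open (V c i)"
    "\<And>ys. distinct ys \<Longrightarrow> \<exists>c. disjoint_up_to (length ys) (V c) \<and> (\<forall>i<length ys. ys ! i \<in> V c i)"
    by (rule separating_open_tuples) blast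
  define A where "A c = (\<Inter>i<Suc N. {x. \<exists>y\<in>V c i. (x, y) \<in> R})" for c
  have analytic_A: "analytic (A c)" for c
    unfolding A_def using V(1) by (intro analytic_INT_less analytic_projection R borel_open)
  have "\<exists>g. g \<in> borel_measurable borel \<and> (\<forall>x\<in>A c. \<forall>y. (x, y) \<in> R \<inter> snd -` V c i \<longrightarrow> y = g x)"
    if "disjoint_up_to (Suc N) (V c)" "i < Suc N" for c i
  proof (rule single_valued_borel_extension)
    have "snd -` V c i \<in> sets (borel :: ('x \<times> 'y) measure)"
      using V(1) by (intro borel_open open_vimage_snd)
    then show "R \<inter> snd -` V c i \<in> sets borel" using R by (rule sets.Int[rotated])
    fix x y y' assume x: "x \<in> A c" and y: "(x, y) \<in> R \<inter> snd -` V c i" "(x, y') \<in> R \<inter> snd -` V c i"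
    show "y = y'"
    proof (rule ccontr)
      assume "y \<noteq> y'"
      \<comment> \<open>Without \<open>y'\<close> the section still meets all \<open>Suc N\<close> sets.\<close>
      have "Suc N \<le> card (R `` {x} - {y'})"
      proof (rule card_ge_disjoint_hits[OF _ that(1)])
        fix j assume j: "j < Suc N"
        show "(R `` {x} - {y'}) \<inter> V c j \<noteq> {}"
        proof (cases "j = i")
          case True
          then show ?thesis using y \<open>y \<noteq> y'\<close> by auto
        next
          case False
          then have "y' \<notin> V c j" using that j y(2) by (auto simp: disjoint_up_to_def)
          moreover obtain z where "z \<in> V c j" "(x, z) \<in> R" using x j by (auto simp: A_def)
          ultimately show ?thesis by auto
        qed
      qed (simp add: fin)
      moreover have "card (R `` {x} - {y'}) < card (R `` {x})"
        using y(2) by (intro card_Diff1_less fin) auto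
      ultimately show False using le[of x] by linarith
    qed
  qed (rule analytic_A)
  then obtain g where
    g: "\<And>c i. disjoint_up_to (Suc N) (V c) \<Longrightarrow> i < Suc N \<Longrightarrow> g c i \<in> borel_measurable borel"
      "\<And>c i x y. disjoint_up_to (Suc N) (V c) \<Longrightarrow> i < Suc N \<Longrightarrow> x \<in> A c \<Longrightarrow> (x, y) \<in> R \<Longrightarrow> y \<in> V c i \<Longrightarrow> y = g c i x"
    by (metis (no_types, lifting) IntI snd_conv vimageI)
  define D where
    "D c = {x. disjoint_up_to (Suc N) (V c) \<and> (\<forall>i<Suc N. (x, g c i x) \<in> R \<and> g c i x \<in> V c i)}" for c
  have D: "D c \<in> sets borel" for c
  proof (cases "disjoint_up_to (Suc N) (V c)")
    case True
    have "{x. (x, g c i x) \<in> R \<and> g c i x \<in> V c i} \<in> sets borel" if "i < Suc N" for i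
    proof -
      have [measurable]: "g c i \<in> borel_measurable borel" "V c i \<in> sets borel"
        using g(1)[OF True that] V(1) by auto
      have "(\<lambda>x. (x, g c i x)) \<in> borel_measurable borel" by measurable
      from measurable_sets[OF this R] measurable_sets[OF \<open>g c i \<in> _\<close> \<open>V c i \<in> _\<close>]
      have "(\<lambda>x. (x, g c i x)) -` R \<inter> g c i -` V c i \<in> sets borel" by auto
      then show ?thesis by (simp add: vimage_def Collect_conj_eq)
    qed
    then have "(\<Inter>i\<in>{..<Suc N}. {x. (x, g c i x) \<in> R \<and> g c i x \<in> V c i}) \<in> sets borel"
      by (intro sets.finite_INT) auto
    moreover have "D c = (\<Inter>i\<in>{..<Suc N}. {x. (x, g c i x) \<in> R \<and> g c i x \<in> V c i})"
      using True by (auto simp: D_def)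
    ultimately show ?thesis by simp
  qed (simp add: D_def)
  have full: "R `` {x} = (\<lambda>i. g c i x) ` {..<Suc N}" if "x \<in> D c" for x c
  proof (rule card_seteq[symmetric, OF fin])
    have "inj_on (\<lambda>i. g c i x) {..<Suc N}"
      using that by (fastforce simp: D_def disjoint_up_to_def inj_on_def)
    then have "card ((\<lambda>i. g c i x) ` {..<Suc N}) = Suc N" by (simp add: card_image)
    then show "card (R `` {x}) \<le> card ((\<lambda>i. g c i x) ` {..<Suc N})" using le by simp
  qed (use that in \<open>auto simp: D_def\<close>)
  define R' where "R' = R - fst -` (\<Union>c. D c)"
  have "borel_enumerable R'"
  proof (rule Suc.IH)
    have "fst -` (\<Union>c. D c) \<in> sets (borel :: ('x \<times> 'y) measure)"
      using measurable_sets[OF borel_measurable_continuous_onI[OF continuous_on_fst[OF continuous_on_id]],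
          of "\<Union>c. D c"] D by auto
    then show "R' \<in> sets borel" unfolding R'_def using R by auto
    fix x
    show "finite (R' `` {x}) \<and> card (R' `` {x}) \<le> N"
    proof (cases "R' `` {x} = {}")
      case False
      then have x: "x \<notin> D c" for c by (auto simp: R'_def)
      then have eq: "R' `` {x} = R `` {x}" by (auto simp: R'_def)
      have "card (R `` {x}) \<noteq> Suc N"
      proof
        assume card: "card (R `` {x}) = Suc N"
        obtain ys where ys: "set ys = R `` {x}" "distinct ys"
          using finite_distinct_list[OF fin] by blast
        then have len: "length ys = Suc N" using card distinct_card[of ys] by simp
        then obtain c where c: "disjoint_up_to (Suc N) (V c)" "\<And>i. i < Suc N \<Longrightarrow> ys ! i \<in> V c i"
          using V(2)[OF ys(2)] by metis
        have mem: "(x, ys ! i) \<in> R" if "i < Suc N" for i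
          using nth_mem[of i ys] that len ys(1) by auto
        then have "x \<in> A c" using c(2) by (auto simp: A_def)
        then have "ys ! i = g c i x" if "i < Suc N" for i
          using g(2)[OF c(1) that _ mem[OF that]] c(2)[OF that] by blast
        then have "x \<in> D c" using c mem by (auto simp: D_def)
        then show False using x by blast
      qed
      then show ?thesis using eq fin le[of x] by simp
    qed simp
  qed
  moreover have "borel_enumerable (R - R')"
  proof (rule borel_enumerableI[of "\<lambda>(c, i). if disjoint_up_to (Suc N) (V c) \<and> i < Suc N then g c i else (\<lambda>_. undefined)"])
    fix p :: "nat \<times> nat"
    show "(case p of (c, i) \<Rightarrow> if disjoint_up_to (Suc N) (V c) \<and> i < Suc N then g c i else (\<lambda>_. undefined))
      \<in> borel_measurable borel"
      using g(1) by (auto split: prod.split)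
  next
    fix x y assume "(x, y) \<in> R - R'"
    then obtain c where "x \<in> D c" "(x, y) \<in> R" by (auto simp: R'_def)
    then obtain i where "i < Suc N" "y = g c i x" using full by blast
    moreover have "disjoint_up_to (Suc N) (V c)" using \<open>x \<in> D c\<close> by (simp add: D_def)
    ultimately show "\<exists>p. y = (case p of (c, i) \<Rightarrow>
        if disjoint_up_to (Suc N) (V c) \<and> i < Suc N then g c i else (\<lambda>_. undefined)) x"
      by (intro exI[of _ "(c, i)"]) simp
  qed
  ultimately show ?case using borel_enumerable_Un[of R' "R - R'"] borel_enumerable_subset by blast
qed

text \<open>The points with at least $n$ elements in their section form analytic sets \<open>P n\<close> with empty
  intersection.  Novikov's theorem provides Borel sets around them that still have empty intersection,
  and off the $n$-th one the sections have fewer than $n$ elements.\<close>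

theorem enumerable_if_finite_sections:
  fixes R :: "('x::polish_space \<times> 'y::polish_space) set"
  assumes "R \<in> sets borel" "\<And>x. finite (R `` {x})"
  shows "borel_enumerable R"
proof -
  obtain V :: "nat \<Rightarrow> nat \<Rightarrow> 'y set" where V: "\<And>c i. open (V c i)"
    "\<And>ys. distinct ys \<Longrightarrow> \<exists>c. disjoint_up_to (length ys) (V c) \<and> (\<forall>i<length ys. ys ! i \<in> V c i)"
    by (rule separating_open_tuples) blast
  define P where "P n = (\<Union>c. if disjoint_up_to n (V c) then (\<Inter>i<n. {x. \<exists>y\<in>V c i. (x, y) \<in> R}) else {})"
    for n
  have P: "x \<in> P n \<longleftrightarrow> n \<le> card (R `` {x})" for x n
  proof
    assume "x \<in> P n"
    then obtain c where c: "x \<in> (if disjoint_up_to n (V c) then (\<Inter>i<n. {x. \<exists>y\<in>V c i. (x, y) \<in> R}) else {})"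
      unfolding P_def by blast
    then have "disjoint_up_to n (V c)" by (auto split: if_splits)
    then show "n \<le> card (R `` {x})"
      using c by (intro card_ge_disjoint_hits[OF assms(2)]) auto
  next
    assume "n \<le> card (R `` {x})"
    then obtain S where S: "S \<subseteq> R `` {x}" "card S = n" "finite S"
      using obtain_subset_with_card_n by metis
    then obtain ys where ys: "set ys = S" "distinct ys" using finite_distinct_list by blast
    then have "length ys = n" using S(2) distinct_card by fastforce
    moreover obtain c where "disjoint_up_to (length ys) (V c)" "\<forall>i<length ys. ys ! i \<in> V c i"
      using V(2)[OF ys(2)] by blast
    ultimately have c: "disjoint_up_to n (V c)" "\<And>i. i < n \<Longrightarrow> ys ! i \<in> V c i \<and> (x, ys ! i) \<in> R"
      using S(1) ys(1) nth_mem[of _ ys] by auto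
    then have "x \<in> (\<Inter>i<n. {x. \<exists>y\<in>V c i. (x, y) \<in> R})" by blast
    then show "x \<in> P n" unfolding P_def using c(1) by auto
  qed
  have "borel_separated P"
  proof (rule novikov_separation)
    fix n
    have "analytic (if disjoint_up_to n (V c) then (\<Inter>i<n. {x. \<exists>y\<in>V c i. (x, y) \<in> R}) else {})" for c
      using analytic_INT_less[of n "\<lambda>i. {x. \<exists>y\<in>V c i. (x, y) \<in> R}"] analytic_projection[OF assms(1)]
        V(1) by (simp add: closed_imp_analytic)
    then show "analytic (P n)" unfolding P_def by (rule analytic_UN)
  next
    have "x \<notin> P (Suc (card (R `` {x})))" for x by (simp add: P)
    then show "(\<Inter>n. P n) = {}" by blast
  qed
  then obtain B where B: "\<And>n. B n \<in> sets borel" "\<And>n. P n \<subseteq> B n" "(\<Inter>n. B n) = {}"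
    unfolding borel_separated_def by blast
  have "borel_enumerable (R - fst -` B n)" for n
  proof (rule enumerable_if_bounded_sections[of _ n])
    have "fst -` B n \<in> sets (borel :: ('x \<times> 'y) measure)"
      using measurable_sets[OF borel_measurable_continuous_onI[OF continuous_on_fst[OF continuous_on_id]],
          of "B n"] B(1) by auto
    then show "R - fst -` B n \<in> sets borel" using assms(1) by auto
    fix x
    show "finite ((R - fst -` B n) `` {x}) \<and> card ((R - fst -` B n) `` {x}) \<le> n"
    proof (cases "x \<in> B n")
      case True
      then have "(R - fst -` B n) `` {x} = {}" by auto
      then show ?thesis by simp
    next
      case False
      then have "(R - fst -` B n) `` {x} = R `` {x}" by auto
      moreover have "\<not> n \<le> card (R `` {x})" using False B(2) P by blast
      ultimately show ?thesis using assms(2) by simp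
    qed
  qed
  then have "borel_enumerable (\<Union>n. R - fst -` B n)" by (rule borel_enumerable_UN)
  moreover have "R \<subseteq> (\<Union>n. R - fst -` B n)" using B(3) by fastforce
  ultimately show ?thesis by (rule borel_enumerable_subset)
qed

section \<open>Borel relations enumerated by Borel functions\<close>

lemma borel_measurable_projections:
  "fst \<in> borel_measurable (borel :: ('x::topological_space \<times> 'y::topological_space) measure)"
  "snd \<in> borel_measurable (borel :: ('x::topological_space \<times> 'y::topological_space) measure)"
  by (auto intro!: borel_measurable_continuous_onI continuous_intros)

lemma borel_vimage_graph:
  fixes g :: "'x::second_countable_topology \<Rightarrow> 'y::second_countable_topology"
  assumes "R \<in> sets borel" "g \<in> borel_measurable borel"
  shows "{x. (x, g x) \<in> R} \<in> sets borel"
proof -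
  have "(\<lambda>x. (x, g x)) \<in> borel_measurable borel" using assms(2) by measurable
  from measurable_sets[OF this assms(1)] show ?thesis by (simp add: vimage_def)
qed

text \<open>The quantifier over the second coordinate becomes a countable union.\<close>

lemma borel_Domain:
  fixes R :: "('x::second_countable_topology \<times> 'y::second_countable_topology) set"
  assumes "R \<in> sets borel" "borel_enumerable R"
  shows "Domain R \<in> sets borel"
proof -
  obtain g :: "nat \<Rightarrow> 'x \<Rightarrow> 'y" where g: "\<And>n. g n \<in> borel_measurable borel"
    "\<And>x y. (x, y) \<in> R \<Longrightarrow> \<exists>n. y = g n x"
    using assms(2) unfolding borel_enumerable_def by blast
  have "Domain R = (\<Union>n. {x. (x, g n x) \<in> R})" using g(2) by blast
  moreover have "{x. (x, g n x) \<in> R} \<in> sets borel" for n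
    using borel_vimage_graph[OF assms(1) g(1)] .
  ultimately show ?thesis by simp
qed

lemma borel_relcomp:
  fixes R :: "('x::second_countable_topology \<times> 'y::second_countable_topology) set"
    and S :: "('y \<times> 'z::second_countable_topology) set"
  assumes "R \<in> sets borel" "borel_enumerable R" "S \<in> sets borel"
  shows "R O S \<in> sets borel"
proof -
  obtain g :: "nat \<Rightarrow> 'x \<Rightarrow> 'y" where g: "\<And>n. g n \<in> borel_measurable borel"
    "\<And>x y. (x, y) \<in> R \<Longrightarrow> \<exists>n. y = g n x"
    using assms(2) unfolding borel_enumerable_def by blast
  have "{p. (fst p, g n (fst p)) \<in> R \<and> (g n (fst p), snd p) \<in> S} \<in> sets borel" for n
  proof -
    note [measurable] = borel_measurable_projections g(1)
    have "(\<lambda>p :: 'x \<times> 'z. (fst p, g n (fst p))) \<in> borel_measurable borel"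
      "(\<lambda>p :: 'x \<times> 'z. (g n (fst p), snd p)) \<in> borel_measurable borel"
      by (intro borel_measurable_Pair borel_measurable_projections
          measurable_compose[OF borel_measurable_projections(1) g(1)])+
    from measurable_sets[OF this(1) assms(1)] measurable_sets[OF this(2) assms(3)]
    show ?thesis by (simp add: vimage_def Collect_conj_eq)
  qed
  moreover have "R O S = (\<Union>n. {p. (fst p, g n (fst p)) \<in> R \<and> (g n (fst p), snd p) \<in> S})"
    using g(2) by force
  ultimately show ?thesis by simp
qed

lemma borel_enumerable_relcomp:
  fixes R :: "('x::second_countable_topology \<times> 'y::second_countable_topology) set"
    and S :: "('y \<times> 'z::second_countable_topology) set"
  assumes "borel_enumerable R" "borel_enumerable S"
  shows "borel_enumerable (R O S)"
proof -
  obtain g :: "nat \<Rightarrow> 'x \<Rightarrow> 'y" where g: "\<And>n. g n \<in> borel_measurable borel"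
    "\<And>x y. (x, y) \<in> R \<Longrightarrow> \<exists>n. y = g n x"
    using assms(1) unfolding borel_enumerable_def by blast
  obtain k :: "nat \<Rightarrow> 'y \<Rightarrow> 'z" where k: "\<And>n. k n \<in> borel_measurable borel"
    "\<And>x y. (x, y) \<in> S \<Longrightarrow> \<exists>n. y = k n x"
    using assms(2) unfolding borel_enumerable_def by blast
  show ?thesis
  proof (rule borel_enumerableI[of "\<lambda>(m, n) x. k n (g m x)"])
    fix p :: "nat \<times> nat"
    show "(case p of (m, n) \<Rightarrow> \<lambda>x. k n (g m x)) \<in> borel_measurable borel"
      using measurable_compose[OF g(1) k(1)] by (auto split: prod.split)
  next
    fix x z assume "(x, z) \<in> R O S"
    then obtain y where "(x, y) \<in> R" "(y, z) \<in> S" by blast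
    then obtain m n where "y = g m x" "z = k n y" using g(2) k(2) by blast
    then show "\<exists>p. z = (case p of (m, n) \<Rightarrow> \<lambda>x. k n (g m x)) x" by (intro exI[of _ "(m, n)"]) simp
  qed
qed

lemma borel_enumerable_Id: "borel_enumerable Id"
  by (rule borel_enumerableI[of "\<lambda>_::nat. \<lambda>x. x"]) auto

lemma borel_Id: "(Id :: ('x::{t2_space,second_countable_topology} \<times> 'x) set) \<in> sets borel"
proof -
  have "(Id :: ('x \<times> 'x) set) = {p. fst p = snd p}" by auto
  moreover have "closed {p :: 'x \<times> 'x. fst p = snd p}"
    by (intro closed_Collect_eq continuous_intros)
  ultimately show ?thesis by simp
qed

lemma
  fixes R :: "('x::{t2_space,second_countable_topology} \<times> 'x) set"
  assumes "R \<in> sets borel" "borel_enumerable R"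
  shows borel_relpow: "R ^^ n \<in> sets borel"
    and borel_enumerable_relpow: "borel_enumerable (R ^^ n)"
proof (induction n)
  case 0
  {
    case 1
    then show ?case by (simp add: borel_Id)
  next
    case 2
    then show ?case by (simp add: borel_enumerable_Id)
  }
next
  case (Suc n)
  {
    case 1
    then show ?case using Suc assms(1) by (simp add: borel_relcomp)
  next
    case 2
    then show ?case using Suc assms(2) by (simp add: borel_enumerable_relcomp)
  }
qed

lemma
  fixes R :: "('x::{t2_space,second_countable_topology} \<times> 'x) set"
  assumes "R \<in> sets borel" "borel_enumerable R"
  shows borel_rtrancl: "R\<^sup>* \<in> sets borel"
    and borel_enumerable_rtrancl: "borel_enumerable (R\<^sup>*)"
  unfolding rtrancl_is_UN_relpow
  using borel_relpow[OF assms] borel_enumerable_relpow[OF assms]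
  by (auto intro: borel_enumerable_UN)

lemma borel_Collect: "Measurable.pred borel P \<Longrightarrow> {x. P x} \<in> sets borel"
  by (simp add: pred_def)

lemma measurable_coordinates:
  fixes f :: "'b \<Rightarrow> 'x::topological_space \<times> 'y::topological_space"
  assumes "f \<in> borel_measurable N"
  shows "(\<lambda>q. fst (f q)) \<in> borel_measurable N" "(\<lambda>q. snd (f q)) \<in> borel_measurable N"
  by (rule measurable_compose[OF assms], rule borel_measurable_projections)+

lemma pred_borel_relation:
  fixes R :: "('x::second_countable_topology \<times> 'y::second_countable_topology) set"
  assumes "R \<in> sets borel" "f \<in> borel_measurable N" "g \<in> borel_measurable N"
  shows "Measurable.pred N (\<lambda>q. (f q, g q) \<in> R)"
  using assms(1) borel_measurable_Pair[OF assms(2,3)] by (rule pred_sets2)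

lemma pred_borel_eq:
  fixes f g :: "'b \<Rightarrow> 'x::{second_countable_topology,t2_space}"
  assumes "f \<in> borel_measurable N" "g \<in> borel_measurable N"
  shows "Measurable.pred N (\<lambda>q. f q = g q)"
  using measurable_equality_set[OF assms] by (simp add: pred_def)

lemmas borel_pred_intros = pred_intros_logic(2-6) pred_intros_countable pred_borel_relation pred_borel_eq
  measurable_coordinates borel_measurable_Pair measurable_ident_sets[OF refl]

lemma borel_converse:
  fixes R :: "('x::second_countable_topology \<times> 'y::second_countable_topology) set"
  assumes "R \<in> sets borel"
  shows "R\<inverse> \<in> sets borel"
proof -
  have "{p. (snd p, fst p) \<in> R} \<in> sets borel"
    by (intro borel_Collect borel_pred_intros assms)
  moreover have "R\<inverse> = {p. (snd p, fst p) \<in> R}" by auto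
  ultimately show ?thesis by simp
qed

lemma relpow_reflcl_mono: "m \<le> n \<Longrightarrow> (R\<^sup>=) ^^ m \<subseteq> (R\<^sup>=) ^^ n"
proof (induction rule: dec_induct)
  case (step n)
  then show ?case by auto
qed simp

lemma rtrancl_eq_UN_relpow_reflcl: "R\<^sup>* = (\<Union>n. (R\<^sup>=) ^^ n)"
  by (metis rtrancl_is_UN_relpow rtrancl_reflcl)

section \<open>Baire category\<close>

lemma nowhere_dense_subset: "nowhere_dense B \<Longrightarrow> A \<subseteq> B \<Longrightarrow> nowhere_dense A"
  unfolding nowhere_dense_def using interior_mono[OF closure_mono, of A B] by auto

lemma meagerI: "(\<And>n::nat. nowhere_dense (N n)) \<Longrightarrow> A \<subseteq> (\<Union>n. N n) \<Longrightarrow> meager A"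
  unfolding meager_def
  by (intro exI[of _ "\<lambda>n. N n \<inter> A"]) (auto intro: nowhere_dense_subset)

lemma meager_subset: "meager B \<Longrightarrow> A \<subseteq> B \<Longrightarrow> meager A"
  using meagerI unfolding meager_def by metis

lemma nowhere_dense_imp_meager: "nowhere_dense A \<Longrightarrow> meager A"
  by (rule meagerI[of "\<lambda>_. A"]) auto

lemma meager_UN:
  assumes "\<And>n::nat. meager (A n)"
  shows "meager (\<Union>n. A n)"
proof -
  have "\<forall>n. \<exists>N :: nat \<Rightarrow> 'a set. (\<forall>k. nowhere_dense (N k)) \<and> A n = (\<Union>k. N k)"
    using assms unfolding meager_def by blast
  then obtain N :: "nat \<Rightarrow> nat \<Rightarrow> 'a set" where N: "\<And>n k. nowhere_dense (N n k)" "\<And>n. A n = (\<Union>k. N n k)"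
    by metis
  show ?thesis
  proof (rule meagerI[of "\<lambda>m. N (fst (prod_decode m)) (snd (prod_decode m))"])
    show "(\<Union>n. A n) \<subseteq> (\<Union>m. N (fst (prod_decode m)) (snd (prod_decode m)))"
    proof
      fix x assume "x \<in> (\<Union>n. A n)"
      then obtain n k where "x \<in> N n k" using N(2) by auto
      then have "x \<in> N (fst (prod_decode (prod_encode (n, k)))) (snd (prod_decode (prod_encode (n, k))))"
        by simp
      then show "x \<in> (\<Union>m. N (fst (prod_decode m)) (snd (prod_decode m)))" by blast
    qed
  qed (rule N(1))
qed

lemma meager_Un:
  assumes "meager A" "meager B"
  shows "meager (A \<union> B)"
proof -
  have "meager (\<Union>n::nat. if n = 0 then A else B)"
    by (rule meager_UN) (simp add: assms)
  then show ?thesis by (rule meager_subset) (auto split: if_splits)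
qed

lemma nowhere_dense_boundary:
  assumes "open U"
  shows "nowhere_dense (closure U - U)"
proof -
  have "closed (closure U - U)" using assms by (simp add: closed_Diff)
  moreover have "interior (closure U - U) = {}"
  proof (rule ccontr)
    assume "interior (closure U - U) \<noteq> {}"
    then obtain x where x: "x \<in> interior (closure U - U)" by blast
    then have "x \<in> closure U" using interior_subset by blast
    then have "interior (closure U - U) \<inter> U \<noteq> {}"
      using x open_Int_closure_eq_empty[OF open_interior] by blast
    then show False using interior_subset[of "closure U - U"] by blast
  qed
  ultimately show ?thesis by (simp add: nowhere_dense_def)
qed

lemma open_not_meager:
  fixes U :: "'a::complete_space set"
  assumes "open U" "U \<noteq> {}"
  shows "\<not> meager U"
proof
  assume "meager U"
  then obtain N :: "nat \<Rightarrow> 'a set" where N: "\<And>n. nowhere_dense (N n)" "U = (\<Union>n. N n)"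
    unfolding meager_def by blast
  have "euclidean interior_of \<Union>(range (\<lambda>n. closure (N n))) = {}"
    by (rule Baire_category_alt)
      (use N(1) in \<open>auto simp: completely_metrizable_space_euclidean nowhere_dense_def\<close>)
  then have "interior (\<Union>n. closure (N n)) = {}" by simp
  moreover have "U \<subseteq> (\<Union>n. closure (N n))" using N(2) closure_subset by blast
  ultimately show False using assms interior_maximal by blast
qed

text \<open>For complements, an open set is exchanged for the complement of its closure; the two differ from
  being complementary only by a nowhere dense boundary.\<close>

lemma borel_imp_baire_property:
  assumes "A \<in> sets borel"
  shows "\<exists>U. open U \<and> meager (sym_diff A U)"
proof -
  have "A \<in> sigma_sets UNIV {S. open S}"
    using assms by (simp add: borel_def)
  then show ?thesis
  proof induction
    case (Basic A)
    then show ?case by (intro exI[of _ A]) (auto intro: nowhere_dense_imp_meager simp: nowhere_dense_def)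
  next
    case Empty
    then show ?case by (intro exI[of _ "{}"]) (auto intro: nowhere_dense_imp_meager simp: nowhere_dense_def)
  next
    case (Compl A)
    then obtain U where U: "open U" "meager (sym_diff A U)" by blast
    have "meager (sym_diff A U \<union> (closure U - U))"
      by (intro meager_Un U nowhere_dense_imp_meager nowhere_dense_boundary)
    then have "meager (sym_diff (UNIV - A) (- closure U))"
      by (rule meager_subset) (use closure_subset[of U] in blast)
    then show ?case by (intro exI[of _ "- closure U"]) (simp add: open_Compl)
  next
    case (Union A)
    then have "\<forall>n. \<exists>U. open U \<and> meager (sym_diff (A n) U)" by blast
    from choice[OF this] obtain U
      where U: "\<And>n. open (U n)" "\<And>n. meager (sym_diff (A n) (U n))" by blast
    have "meager (\<Union>n. sym_diff (A n) (U n))" by (rule meager_UN) (rule U)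
    then have "meager (sym_diff (\<Union>n. A n) (\<Union>n. U n))" by (rule meager_subset) blast
    then show ?case using U(1) by (intro exI[of _ "\<Union>n. U n"]) auto
  qed
qed

text \<open>If each set of the cover were almost equal to an open set missing \<open>U\<close>, then \<open>U\<close> would be meager.\<close>

lemma borel_cover_comeager_somewhere:
  fixes A :: "nat \<Rightarrow> 'a::complete_space set"
  assumes "\<And>c. A c \<in> sets borel" "(\<Union>c. A c) = UNIV" "open U" "U \<noteq> {}"
  obtains c V where "open V" "V \<noteq> {}" "V \<subseteq> U" "meager (V - A c)"
proof -
  have "\<forall>c. \<exists>W. open W \<and> meager (sym_diff (A c) W)"
    using borel_imp_baire_property assms(1) by blast
  from choice[OF this] obtain W
    where W: "\<And>c. open (W c)" "\<And>c. meager (sym_diff (A c) (W c))" by blast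
  have "\<exists>c. W c \<inter> U \<noteq> {}"
  proof (rule ccontr)
    assume *: "\<nexists>c. W c \<inter> U \<noteq> {}"
    have "meager (\<Union>c. sym_diff (A c) (W c))" by (rule meager_UN) (rule W)
    moreover have "U \<subseteq> (\<Union>c. sym_diff (A c) (W c))"
    proof
      fix x assume "x \<in> U"
      have "x \<in> (\<Union>c. A c)" using assms(2) by (simp only: UNIV_I)
      then obtain c where "x \<in> A c" by (rule UN_E)
      moreover have "x \<notin> W c" using * \<open>x \<in> U\<close> by blast
      ultimately show "x \<in> (\<Union>c. sym_diff (A c) (W c))" by blast
    qed
    ultimately have "meager U" by (rule meager_subset)
    then show False using open_not_meager assms(3,4) by blast
  qed
  then obtain c where "W c \<inter> U \<noteq> {}" by blast
  moreover have "meager (W c \<inter> U - A c)" using W(2)[of c] by (rule meager_subset) blast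
  ultimately show thesis using that[of "W c \<inter> U" c] W(1) assms(3) by blast
qed

lemma open_base_sequence:
  obtains B :: "nat \<Rightarrow> 'a::second_countable_topology set"
  where "\<And>b. open (B b)" "\<And>b. B b \<noteq> {}" "\<And>U x. open U \<Longrightarrow> x \<in> U \<Longrightarrow> \<exists>b. x \<in> B b \<and> B b \<subseteq> U"
proof -
  obtain \<B> :: "'a set set" where \<B>: "countable \<B>" "topological_basis \<B>"
    using ex_countable_basis by blast
  define \<C> where "\<C> = \<B> - {{}}"
  have base: "\<exists>b\<in>\<C>. x \<in> b \<and> b \<subseteq> U" if Ux: "open U" "x \<in> U" for U x
  proof -
    obtain b where "b \<in> \<B>" "x \<in> b" "b \<subseteq> U"
      by (rule topological_basisE[OF \<B>(2) Ux])
    then show ?thesis unfolding \<C>_def by blast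
  qed
  have "\<C> \<noteq> {}" "countable \<C>" using base[of UNIV] \<B>(1) by (auto simp: \<C>_def)
  then have range: "range (from_nat_into \<C>) = \<C>" by (rule range_from_nat_into)
  then have in_C: "from_nat_into \<C> b \<in> \<C>" for b by blast
  show thesis
  proof (rule that[of "from_nat_into \<C>"])
    show "open (from_nat_into \<C> b)" "from_nat_into \<C> b \<noteq> {}" for b
      using in_C[of b] topological_basis_open[OF \<B>(2)] by (auto simp: \<C>_def)
    show "\<exists>b. x \<in> from_nat_into \<C> b \<and> from_nat_into \<C> b \<subseteq> U" if "open U" "x \<in> U" for U x
      using base[OF that] range by (metis (no_types, lifting) rangeE)
  qed
qed

text \<open>Stage $t$ codes a pair of a basic open set and an index $n$.  The extensions of the current state
  cover the space, so the preimages under \<open>h n\<close> of what they cover do so too, and one of them can be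
  chosen whose preimage is comeager in some open subset of the basic open set.  In the end, for
  every $n$, the points mapped by \<open>h n\<close> to a covered point are comeager in a dense open set.\<close>

lemma generic_sequence:
  fixes h :: "nat \<Rightarrow> 'a::polish_space \<Rightarrow> 'a" and D :: "'s \<Rightarrow> 'a set"
  assumes h: "\<And>n. h n \<in> borel_measurable borel"
    and start: "good s0"
    and borel: "\<And>s. good s \<Longrightarrow> D s \<in> sets borel"
    and extensions: "\<And>s. good s \<Longrightarrow> \<exists>e :: nat \<Rightarrow> 's. (\<forall>c. good (e c) \<and> extends s (e c)) \<and> (\<Union>c. D (e c)) = UNIV"
  obtains S where "\<And>t::nat. good (S t)" "\<And>t. extends (S t) (S (Suc t))"
    "comeager {x. \<forall>n. h n x \<in> (\<Union>t. D (S t))}"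
proof -
  obtain B :: "nat \<Rightarrow> 'a set" where B: "\<And>b. open (B b)" "\<And>b. B b \<noteq> {}"
    "\<And>U x. open U \<Longrightarrow> x \<in> U \<Longrightarrow> \<exists>b. x \<in> B b \<and> B b \<subseteq> U"
    by (rule open_base_sequence) (rule that)
  define reached where "reached b n s \<longleftrightarrow>
      (\<exists>V. open V \<and> V \<noteq> {} \<and> V \<subseteq> B b \<and> meager (V - {x. h n x \<in> D s}))" for b n s
  have step: "\<exists>s'. good s' \<and> extends s s' \<and> reached b n s'" if s: "good s" for s b n
  proof -
    from extensions[OF s] obtain e :: "nat \<Rightarrow> 's" where
      e: "(\<forall>c. good (e c) \<and> extends s (e c)) \<and> (\<Union>c. D (e c)) = UNIV" ..
    then have good: "good (e c)" and ext: "extends s (e c)" for c by blast+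
    have meas: "{x. h n x \<in> D (e c)} \<in> sets borel" for c
      using measurable_sets[OF h borel[OF good], of n c] by (simp add: vimage_def)
    have "h n x \<in> (\<Union>c. D (e c))" for x using e by simp
    then have cover: "(\<Union>c. {x. h n x \<in> D (e c)}) = UNIV" by auto
    obtain c V where "open V" "V \<noteq> {}" "V \<subseteq> B b" "meager (V - {x. h n x \<in> D (e c)})"
      by (rule borel_cover_comeager_somewhere[OF meas cover B(1,2)])
    then have "reached b n (e c)" unfolding reached_def by blast
    then show ?thesis using good ext by blast
  qed
  have "\<exists>S. \<forall>t. good (S t) \<and> (extends (S t) (S (Suc t)) \<and>
      reached (fst (prod_decode t)) (snd (prod_decode t)) (S (Suc t)))"
    by (rule dependent_nat_choice) (use start step in blast)+
  then obtain S where S: "\<And>t. good (S t)" "\<And>t. extends (S t) (S (Suc t))"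
    "\<And>t. reached (fst (prod_decode t)) (snd (prod_decode t)) (S (Suc t))"
    by blast
  have "meager (- {x. h n x \<in> (\<Union>t. D (S t))})" for n
  proof -
    have "\<forall>b. \<exists>V. open V \<and> V \<noteq> {} \<and> V \<subseteq> B b \<and> meager (V - {x. h n x \<in> (\<Union>t. D (S t))})"
    proof
      fix b
      obtain V where V: "open V" "V \<noteq> {}" "V \<subseteq> B b"
        "meager (V - {x. h n x \<in> D (S (Suc (prod_encode (b, n))))})"
        using S(3)[of "prod_encode (b, n)"] unfolding reached_def by auto
      then have "meager (V - {x. h n x \<in> (\<Union>t. D (S t))})"
        by (elim meager_subset) blast
      then show "\<exists>V. open V \<and> V \<noteq> {} \<and> V \<subseteq> B b \<and> meager (V - {x. h n x \<in> (\<Union>t. D (S t))})"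
        using V(1-3) by blast
    qed
    from choice[OF this] obtain V where V: "\<And>b. open (V b)" "\<And>b. V b \<noteq> {}" "\<And>b. V b \<subseteq> B b"
      "\<And>b. meager (V b - {x. h n x \<in> (\<Union>t. D (S t))})"
      by blast
    have "closure (\<Union>b. V b) = UNIV"
    proof (rule ccontr)
      assume "closure (\<Union>b. V b) \<noteq> UNIV"
      then obtain x where "x \<in> - closure (\<Union>b. V b)" by auto
      then obtain b where "B b \<subseteq> - closure (\<Union>b. V b)"
        using B(3)[OF open_Compl[OF closed_closure]] by metis
      moreover have "V b \<subseteq> closure (\<Union>b. V b)"
        using closure_subset[of "\<Union>b. V b"] UN_upper[of b UNIV V] by simp
      ultimately have "V b \<subseteq> {}" using V(3)[of b] by fast
      then show False using V(2)[of b] by simp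
    qed
    moreover have "closed (- (\<Union>b. V b))" using V(1) by (intro closed_Compl open_UN ballI)
    ultimately have "nowhere_dense (- (\<Union>b. V b))"
      unfolding nowhere_dense_def
      by (simp only: closure_closed interior_complement Compl_UNIV_eq)
    then have "meager (- (\<Union>b. V b) \<union> (\<Union>b. V b - {x. h n x \<in> (\<Union>t. D (S t))}))"
      by (intro meager_Un nowhere_dense_imp_meager meager_UN V(4))
    then show ?thesis by (rule meager_subset) blast
  qed
  then have "meager (\<Union>n. - {x. h n x \<in> (\<Union>t. D (S t))})" by (rule meager_UN)
  then have "comeager {x. \<forall>n. h n x \<in> (\<Union>t. D (S t))}"
    unfolding comeager_def by (rule meager_subset) blast
  then show thesis using that S by blast
qed

section \<open>Forced edges in acyclic graphs\<close>

text \<open>Walks grow at the front of the list, so \<open>hd\<close> is the vertex reached so far.\<close>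

fun nonbacktracking :: "('a \<times> 'a) set \<Rightarrow> 'a list \<Rightarrow> bool" where
  "nonbacktracking G [] = False"
| "nonbacktracking G [x] = True"
| "nonbacktracking G [x, y] = ((x, y) \<in> G)"
| "nonbacktracking G (x # y # z # zs) = ((x, y) \<in> G \<and> x \<noteq> z \<and> nonbacktracking G (y # z # zs))"

text \<open>Oriented edges are pairs, and $(p, v)$ leads to $(z, w)$ if $p, v, z, w$ is a nonbacktracking walk.\<close>

definition two_step :: "('a \<times> 'a) set \<Rightarrow> (('a \<times> 'a) \<times> ('a \<times> 'a)) set" where
  "two_step H = {((p, v), (z, w)). (p, v) \<in> H \<and> (v, z) \<in> H \<and> z \<noteq> p \<and> (z, w) \<in> H \<and> w \<noteq> v}"

text \<open>Once $p$ and $v$ are matched with each other, $w$ is the only partner left for $z$.\<close>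

definition forced :: "('a \<times> 'a) set \<Rightarrow> (('a \<times> 'a) \<times> ('a \<times> 'a)) set" where
  "forced H = {((p, v), (z, w)). ((p, v), (z, w)) \<in> two_step H \<and> (\<forall>u. (z, u) \<in> H \<longrightarrow> u = v \<or> u = w)}"

text \<open>Both orientations of \<open>e\<close> are starting points, since the forced moves spread from both ends of \<open>e\<close>.\<close>

definition forced_edges :: "('a \<times> 'a) set \<Rightarrow> 'a \<times> 'a \<Rightarrow> ('a \<times> 'a) set" where
  "forced_edges H e = (forced H)\<^sup>* `` {e, prod.swap e}"

text \<open>The optional step that need not be forced leads from an end \<open>u\<close> of a forced edge to a neighbour that may have partners to spare.
  If \<open>u\<close> is removed and this neighbour is left with two neighbours, then a walk through it may become
  forced; from there it continues along edges that were forced before.\<close>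

definition nearby_edges :: "('a \<times> 'a) set \<Rightarrow> 'a \<times> 'a \<Rightarrow> ('a \<times> 'a) set" where
  "nearby_edges H e = (forced H)\<^sup>* `` ((two_step H)\<^sup>= `` forced_edges H e)"

definition residual :: "('a \<times> 'a) set \<Rightarrow> ('a \<times> 'a) set \<Rightarrow> ('a \<times> 'a) set" where
  "residual G M = G \<inter> (- Domain M) \<times> (- Domain M)"

text \<open>The last condition expresses that no injective ray in the residual graph has degree two on even
  indices.  As well-foundedness it provides the induction that replaces Koenig's lemma in
  \<open>finite_forced_reachable\<close>.\<close>

definition extendable :: "('a \<times> 'a) set \<Rightarrow> ('a \<times> 'a) set \<Rightarrow> bool" where
  "extendable G M \<longleftrightarrow> M \<subseteq> G \<and> sym M \<and> single_valued M \<and>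
    (\<forall>x. x \<notin> Domain M \<longrightarrow> (\<forall>u. \<exists>w. (x, w) \<in> residual G M \<and> w \<noteq> u)) \<and>
    wf ((forced (residual G M))\<inverse>)"

text \<open>The relation \<open>G\<^sup>= O G\<^sup>=\<close> is distance at most two.\<close>

definition isolated_edges :: "('a \<times> 'a) set \<Rightarrow> ('a \<times> 'a) set \<Rightarrow> ('a \<times> 'a) set \<Rightarrow> bool" where
  "isolated_edges G H Q \<longleftrightarrow> Q \<subseteq> H \<and>
    (\<forall>e\<in>Q. \<forall>e'\<in>Q. \<forall>u\<in>Field (nearby_edges H e). \<forall>u'\<in>Field (nearby_edges H e').
      (u, u') \<in> G\<^sup>= O G\<^sup>= \<longrightarrow> e = e')"

definition match_forced :: "('a \<times> 'a) set \<Rightarrow> ('a \<times> 'a) set \<Rightarrow> ('a \<times> 'a) set" where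
  "match_forced H Q = (\<Union>e\<in>Q. forced_edges H e \<union> (forced_edges H e)\<inverse>)"

lemma forced_subset_two_step: "forced H \<subseteq> two_step H"
  by (auto simp: forced_def)

lemma two_step_mono: "H \<subseteq> K \<Longrightarrow> two_step H \<subseteq> two_step K"
  by (auto simp: two_step_def)

lemma forced_edges_subset:
  assumes "sym H" "e \<in> H"
  shows "forced_edges H e \<subseteq> H"
proof
  fix e' assume "e' \<in> forced_edges H e"
  then obtain e0 where e0: "e0 \<in> {e, prod.swap e}" "(e0, e') \<in> (forced H)\<^sup>*"
    by (auto simp: forced_edges_def)
  have "e0 \<in> H" using e0(1) assms by (cases e) (auto dest: symD)
  with e0(2) show "e' \<in> H"
    by (induction rule: rtrancl_induct) (auto simp: forced_def two_step_def)
qed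

lemma forced_edges_subset_nearby: "forced_edges H e \<subseteq> nearby_edges H e"
  unfolding nearby_edges_def by blast

lemma forced_edges_step:
  "e' \<in> forced_edges H e \<Longrightarrow> (e', e'') \<in> forced H \<Longrightarrow> e'' \<in> forced_edges H e"
  unfolding forced_edges_def by (auto intro: rtrancl_into_rtrancl)

lemma forced_edges_cases:
  assumes "e' \<in> forced_edges H e"
  obtains "e' \<in> {e, prod.swap e}" | e'' where "e'' \<in> forced_edges H e" "(e'', e') \<in> forced H"
proof -
  obtain e0 where e0: "e0 \<in> {e, prod.swap e}" "(e0, e') \<in> (forced H)\<^sup>*"
    using assms unfolding forced_edges_def by blast
  from e0(2) show thesis
  proof (cases rule: rtranclE)
    case base
    then show thesis using e0(1) that(1) by simp
  next
    case (step e'')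
    then have "e'' \<in> forced_edges H e" using e0(1) unfolding forced_edges_def by blast
    then show thesis using step(2) that(2) by blast
  qed
qed

lemma nearby_edges_two_step:
  assumes "e \<in> H" "sym H" "e' \<in> nearby_edges H e"
  shows "\<exists>e0\<in>{e, prod.swap e}. (e0, e') \<in> (two_step H)\<^sup>*"
proof -
  obtain e0 e1 e2 where e0: "e0 \<in> {e, prod.swap e}" "(e0, e1) \<in> (forced H)\<^sup>*"
    "(e1, e2) \<in> (two_step H)\<^sup>=" "(e2, e') \<in> (forced H)\<^sup>*"
    using assms(3) unfolding nearby_edges_def forced_edges_def by blast
  have mono: "(forced H)\<^sup>* \<subseteq> (two_step H)\<^sup>*" by (rule rtrancl_mono[OF forced_subset_two_step])
  have "(e0, e1) \<in> (two_step H)\<^sup>*" "(e1, e2) \<in> (two_step H)\<^sup>*" "(e2, e') \<in> (two_step H)\<^sup>*"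
    using e0 mono by auto
  then show ?thesis using e0(1) by (meson rtrancl_trans)
qed

lemma finite_forced_reachable:
  assumes "wf ((forced H)\<inverse>)" "\<And>x. finite (H `` {x})"
  shows "finite ((forced H)\<^sup>* `` {e})" "finite (two_step H `` {e})"
proof -
  have two: "finite (two_step H `` {e})" for e
  proof -
    have "two_step H `` {e} \<subseteq> (\<Union>z\<in>H `` {snd e}. {z} \<times> H `` {z})"
      by (cases e) (auto simp: two_step_def)
    moreover have "finite (\<Union>z\<in>H `` {snd e}. {z} \<times> H `` {z})" using assms(2) by auto
    ultimately show ?thesis by (rule finite_subset)
  qed
  then show "finite (two_step H `` {e})" .
  from assms(1) show "finite ((forced H)\<^sup>* `` {e})"
  proof (induction e rule: wf_induct_rule)
    case (less e)
    have "(forced H)\<^sup>* `` {e} = insert e (\<Union>e'\<in>forced H `` {e}. (forced H)\<^sup>* `` {e'})"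
      by (auto intro: converse_rtrancl_into_rtrancl elim: converse_rtranclE)
    moreover have "finite (forced H `` {e})"
      using two[of e] forced_subset_two_step[of H] by (meson Image_mono finite_subset order_refl)
    moreover have "finite ((forced H)\<^sup>* `` {e'})" if "e' \<in> forced H `` {e}" for e'
      using less.IH[of e'] that by simp
    ultimately show ?case by (simp only: finite_insert finite_UN_I)
  qed
qed

lemma finite_Image_pointwise:
  assumes "finite A" "\<And>x. finite (R `` {x})"
  shows "finite (R `` A)"
  by (subst Image_eq_UN) (rule finite_UN_I[OF assms])

lemma finite_nearby_edges:
  assumes "wf ((forced H)\<inverse>)" "\<And>x. finite (H `` {x})"
  shows "finite (nearby_edges H e)"
proof -
  note fin = finite_forced_reachable[OF assms]
  have fin2: "finite ((two_step H)\<^sup>= `` {e})" for e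
  proof -
    have "(two_step H)\<^sup>= `` {e} = insert e (two_step H `` {e})" by blast
    then show ?thesis using fin(2)[of e] by (simp only: finite_insert)
  qed
  have "finite (forced_edges H e)"
    unfolding forced_edges_def by (rule finite_Image_pointwise[OF _ fin(1)]) simp
  then show ?thesis
    unfolding nearby_edges_def
    by (rule finite_Image_pointwise[OF finite_Image_pointwise[OF _ fin2] fin(1)])
qed

locale forest =
  fixes G :: "('a \<times> 'a) set"
  assumes symG: "sym G" and irreflG: "irrefl G" and acyclicG: "acyclic_graph G"
begin

lemma nonbacktracking_path: "nonbacktracking G xs \<Longrightarrow> graph_path G xs"
proof (induction G xs rule: nonbacktracking.induct)
  case (4 G x y z zs)
  then have path: "graph_path G (y # z # zs)" and "(x, y) \<in> G" by auto
  show ?case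
    unfolding graph_path_def
  proof (intro conjI allI impI)
    fix i assume i: "Suc i < length (x # y # z # zs)"
    show "((x # y # z # zs) ! i, (x # y # z # zs) ! Suc i) \<in> G"
    proof (cases i)
      case (Suc j)
      then show ?thesis using path i unfolding graph_path_def by simp
    qed (use \<open>(x, y) \<in> G\<close> in simp)
  qed simp
qed (auto simp: graph_path_def)

text \<open>At the first repetition \<open>x\<close>, the walk from its neighbour \<open>y\<close> back to \<open>x\<close> and the single edge
  between them are two injective paths with the same ends.\<close>

lemma nonbacktracking_distinct: "nonbacktracking G xs \<Longrightarrow> distinct xs"
proof (induction xs)
  case (Cons x ys)
  show ?case
  proof (cases ys)
    case Nil
    then show ?thesis by simp
  next
    case ys: (Cons y zs)
    have xy: "(x, y) \<in> G" using Cons.prems ys by (cases zs) auto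
    have ys_ok: "nonbacktracking G ys" using Cons.prems ys by (cases zs) auto
    then have dist: "distinct ys" by (rule Cons.IH)
    have "x \<notin> set ys"
    proof
      assume "x \<in> set ys"
      then obtain i where i: "i < length ys" "ys ! i = x" by (auto simp: in_set_conv_nth)
      have "ys ! 0 \<noteq> x" using xy irreflG ys by (auto simp: irrefl_def)
      moreover have "ys ! 1 \<noteq> x" if "1 < length ys"
        using Cons.prems ys that by (cases zs) auto
      ultimately have "2 \<le> i" using i by (cases i; cases "i - 1") auto
      define as where "as = take (Suc i) ys"
      have len: "length as = Suc i" using i by (simp add: as_def)
      have "graph_path G as"
        using nonbacktracking_path[OF ys_ok] unfolding graph_path_def as_def by auto
      moreover have "distinct as" using dist by (simp add: as_def)
      moreover have "hd as = y" using ys by (simp add: as_def)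
      moreover have "last as = x" using i by (simp add: as_def take_Suc_conv_app_nth)
      moreover have "graph_path G [y, x]" "distinct [y, x]"
        using xy symG irreflG by (auto simp: graph_path_def irrefl_def dest: symD)
      ultimately have "as = [y, x]"
        using acyclicG unfolding acyclic_graph_def by (metis last_ConsL last_ConsR list.sel(1) list.simps(3))
      then show False using len \<open>2 \<le> i\<close> by simp
    qed
    then show ?thesis using dist by simp
  qed
qed simp

lemma nonbacktracking_unique:
  assumes "nonbacktracking G xs" "nonbacktracking G ys" "hd xs = hd ys" "last xs = last ys"
  shows "xs = ys"
  using assms acyclicG nonbacktracking_path nonbacktracking_distinct unfolding acyclic_graph_def by blast

text \<open>A walk from the edge \<open>e\<close>, which may be entered in either direction.\<close>

definition rooted :: "'a \<times> 'a \<Rightarrow> 'a list \<Rightarrow> bool" where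
  "rooted e xs \<longleftrightarrow> nonbacktracking G xs \<and>
    (\<exists>us. xs = us @ [fst e, snd e] \<or> xs = us @ [snd e, fst e])"

lemma nonbacktracking_butlast:
  "nonbacktracking G (xs @ [a, b]) \<Longrightarrow> nonbacktracking G (xs @ [a])"
proof (induction xs)
  case (Cons x xs)
  then show ?case by (cases xs; cases "tl xs") auto
qed simp

text \<open>Walks that enter the root edge in opposite directions cannot meet again: dropping the last vertex of
  the first would give two paths between the same ends.\<close>

lemma rooted_unique_aux:
  assumes "nonbacktracking G (us @ [b, a])" "nonbacktracking G (vs @ [a, b])"
  shows "hd (us @ [b, a]) \<noteq> hd (vs @ [a, b])"
proof
  assume "hd (us @ [b, a]) = hd (vs @ [a, b])"
  then have "hd (us @ [b]) = hd (vs @ [a, b])" by (cases us) auto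
  then have "us @ [b] = vs @ [a, b]"
    by (intro nonbacktracking_unique nonbacktracking_butlast[OF assms(1)] assms(2)) auto
  then have "us = vs @ [a]" by simp
  then show False using nonbacktracking_distinct[OF assms(1)] by simp
qed

lemma rooted_unique:
  assumes "rooted e xs" "rooted e ys" "hd xs = hd ys"
  shows "xs = ys"
proof -
  obtain us vs where us: "xs = us @ [fst e, snd e] \<or> xs = us @ [snd e, fst e]"
    and vs: "ys = vs @ [fst e, snd e] \<or> ys = vs @ [snd e, fst e]"
    using assms(1,2) unfolding rooted_def by blast
  have nb: "nonbacktracking G xs" "nonbacktracking G ys"
    using assms(1,2) unfolding rooted_def by blast+
  have "last xs = last ys"
    using us vs nb assms(3) rooted_unique_aux by fastforce
  then show ?thesis using nonbacktracking_unique[OF nb assms(3)] by blast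
qed

lemma rooted_Cons:
  "rooted e (d # c # zs) \<Longrightarrow> (w, d) \<in> G \<Longrightarrow> w \<noteq> c \<Longrightarrow> rooted e (w # d # c # zs)"
  unfolding rooted_def by (auto intro: exI[of _ "w # _"])

text \<open>The parity separates the two roles of a vertex on a forced edge: the list is even for its second vertex,
  and hence odd for its first vertex unless the edge is the root.\<close>

lemma rooted_two_step:
  assumes "e \<in> G" "e0 \<in> {e, prod.swap e}" "(e0, e') \<in> (two_step G)\<^sup>*"
  shows "\<exists>zs. rooted e (snd e' # fst e' # zs) \<and> even (length zs)"
  using assms(3)
proof (induction rule: rtrancl_induct)
  case base
  have "e0 = e \<or> e0 = (snd e, fst e)" using assms(2) by (cases e) auto
  moreover have "(fst e, snd e) \<in> G" "(snd e, fst e) \<in> G"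
    using assms(1) symD[OF symG, of "fst e" "snd e"] by auto
  ultimately have "rooted e [snd e0, fst e0]" by (auto simp: rooted_def)
  then show ?case by (intro exI[of _ "[]"]) simp
next
  case (step e1 e2)
  then obtain zs where zs: "rooted e (snd e1 # fst e1 # zs)" "even (length zs)" by blast
  have "(snd e1, fst e2) \<in> G" "fst e2 \<noteq> fst e1" "(fst e2, snd e2) \<in> G" "snd e2 \<noteq> snd e1"
    using step(2) by (auto simp: two_step_def)
  moreover from this have "(fst e2, snd e1) \<in> G" "(snd e2, fst e2) \<in> G"
    using symD[OF symG] by blast+
  ultimately have "rooted e (snd e2 # fst e2 # snd e1 # fst e1 # zs)"
    using zs(1) by (intro rooted_Cons)
  then show ?case using zs(2) by (intro exI[of _ "snd e1 # fst e1 # zs"]) simp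
qed

end

locale residual_forest = forest +
  fixes H :: "('a \<times> 'a) set"
  assumes subH: "H \<subseteq> G" and symH: "sym H"
begin

lemma nearby_edges_rooted:
  assumes "e \<in> H" "e' \<in> nearby_edges H e"
  shows "\<exists>zs. rooted e (snd e' # fst e' # zs) \<and> even (length zs)"
proof -
  obtain e0 where "e0 \<in> {e, prod.swap e}" "(e0, e') \<in> (two_step H)\<^sup>*"
    using nearby_edges_two_step[OF assms(1) symH assms(2)] by blast
  moreover have "(two_step H)\<^sup>* \<subseteq> (two_step G)\<^sup>*" by (rule rtrancl_mono[OF two_step_mono[OF subH]])
  ultimately show ?thesis using rooted_two_step[of e e0 e'] assms(1) subH by blast
qed

lemma forced_edges_rooted:
  assumes "e \<in> H" "(c, d) \<in> forced_edges H e"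
  shows "\<exists>zs. rooted e (d # c # zs) \<and> even (length zs)"
  using nearby_edges_rooted[of e "(c, d)"] assms forced_edges_subset_nearby[of H e] by auto

lemma forced_edges_fst_cases:
  assumes "e \<in> H" "(c, d) \<in> forced_edges H e"
  obtains "rooted e [c, d]"
  | p v zs where "(p, v) \<in> forced_edges H e" "((p, v), (c, d)) \<in> forced H"
      "rooted e (c # v # p # zs)" "even (length zs)"
proof (cases rule: forced_edges_cases[OF assms(2)])
  case 1
  then have "rooted e [d, c]" "rooted e [c, d]"
    using assms(1) subH symG by (cases e; force simp: rooted_def dest: symD)+
  then show ?thesis using that(1) by blast
next
  case (2 e'')
  obtain p v where e'': "e'' = (p, v)" by (cases e'')
  then obtain zs where "rooted e (v # p # zs)" "even (length zs)"
    using forced_edges_rooted[OF assms(1)] 2(1) by blast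
  moreover have "(c, v) \<in> G" "c \<noteq> p"
    using 2(2) subH symG by (auto simp: e'' forced_def two_step_def dest: symD)
  ultimately show ?thesis using that(2)[of p v zs] 2 rooted_Cons by (simp add: e'')
qed

lemma forced_edges_snd_unique:
  assumes "e \<in> H" "(b, a) \<in> forced_edges H e" "(b', a) \<in> forced_edges H e"
  shows "b = b'"
proof -
  obtain zs zs' where "rooted e (a # b # zs)" "rooted e (a # b' # zs')"
    using forced_edges_rooted[OF assms(1)] assms(2,3) by blast
  then show ?thesis using rooted_unique[of e "a # b # zs" "a # b' # zs'"] by simp
qed

text \<open>By parity, this happens only if the two pairs are the two orientations of the root edge.\<close>

lemma forced_edges_alternate:
  assumes "e \<in> H" "(c, d) \<in> forced_edges H e" "(b, c) \<in> forced_edges H e"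
  shows "b = d"
proof -
  obtain zs where zs: "rooted e (c # b # zs)" "even (length zs)"
    using forced_edges_rooted[OF assms(1,3)] by blast
  from assms(1,2) show ?thesis
  proof (cases rule: forced_edges_fst_cases)
    case 1
    then show ?thesis using rooted_unique[OF zs(1)] by fastforce
  next
    case (2 p v ys)
    then have "c # b # zs = c # v # p # ys" using rooted_unique[OF zs(1)] by fastforce
    then show ?thesis using zs(2) 2(4) by simp
  qed
qed

lemma forced_edges_fst_unique:
  assumes "e \<in> H" "(c, d) \<in> forced_edges H e" "(c, d') \<in> forced_edges H e"
  shows "d = d'"
  using assms(1,2)
proof (cases rule: forced_edges_fst_cases)
  case 1
  from assms(1,3) show ?thesis
  proof (cases rule: forced_edges_fst_cases)
    case 1
    then show ?thesis using rooted_unique[OF \<open>rooted e [c, d]\<close>] by fastforce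
  next
    case (2 p v zs)
    then show ?thesis using rooted_unique[OF \<open>rooted e [c, d]\<close>] by fastforce
  qed
next
  case cd: (2 p v zs)
  from assms(1,3) show ?thesis
  proof (cases rule: forced_edges_fst_cases)
    case 1
    then show ?thesis using rooted_unique[OF 1 cd(3)] by simp
  next
    case (2 p' v' zs')
    then have "v' = v" using rooted_unique[OF cd(3), of "c # v' # p' # zs'"] by simp
    then show ?thesis using 2(2) cd(2) by (auto simp: forced_def two_step_def)
  qed
qed

lemma single_valued_forced_edges:
  assumes "e \<in> H"
  shows "single_valued (forced_edges H e \<union> (forced_edges H e)\<inverse>)"
  using forced_edges_snd_unique[OF assms] forced_edges_alternate[OF assms]
    forced_edges_fst_unique[OF assms]
  unfolding single_valued_def by blast

text \<open>The first vertex of a forced edge other than the root has only two neighbours, both of which are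
  covered.  So the piece can be left only from a second vertex.\<close>

lemma boundary_of_forced_edges:
  assumes "e \<in> H" "u \<in> Field (forced_edges H e)" "v \<notin> Field (forced_edges H e)" "(u, v) \<in> H"
  shows "\<exists>p. (p, u) \<in> forced_edges H e"
proof -
  from assms(2) consider p where "(p, u) \<in> forced_edges H e" | w where "(u, w) \<in> forced_edges H e"
    unfolding Field_def by blast
  then show ?thesis
  proof cases
    case (2 w)
    show ?thesis
    proof (cases rule: forced_edges_cases[OF 2])
      case 1
      then have "(w, u) \<in> forced_edges H e" by (cases e) (auto simp: forced_edges_def)
      then show ?thesis by blast
    next
      case (2 e'')
      then have "v = snd e'' \<or> v = w"
        using assms(4) by (cases e'') (auto simp: forced_def)
      moreover have "snd e'' \<in> Field (forced_edges H e)" "w \<in> Field (forced_edges H e)"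
        using 2(1) \<open>(u, w) \<in> _\<close> by (cases e''; auto simp: Field_def)+
      ultimately show ?thesis using assms(3) by blast
    qed
  qed blast
qed

lemma boundary_rooted:
  assumes "e \<in> H" "(p, u) \<in> forced_edges H e" "v \<notin> Field (forced_edges H e)" "(u, v) \<in> H"
  shows "\<exists>zs. rooted e (v # u # p # zs)"
proof -
  have "v \<noteq> p" using assms(2,3) by (auto simp: Field_def)
  moreover have "(v, u) \<in> G" using assms(4) subH symG by (auto dest: symD)
  ultimately show ?thesis using forced_edges_rooted[OF assms(1,2)] rooted_Cons by blast
qed

end

lemma sym_residual: "sym G \<Longrightarrow> sym (residual G M)"
  by (auto simp: residual_def sym_def)

context forest
begin

text \<open>By \<open>boundary_of_forced_edges\<close> and the distance between the pieces, a remaining vertex loses at most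
  one neighbour, and it had at least three if it loses one, as it would be covered by a forced edge otherwise.

  An infinite run of forced moves in the new residual graph contains infinitely many moves that were not forced
  before.  Each of them passes a vertex that has lost a neighbour to some piece.  Between two consecutive ones
  the moves were forced before, so the second one happens near the piece of the first.  As the pieces are
  far apart, both neighbours were lost to the same piece, which yields two walks from its root to the same
  vertex.\<close>

theorem extendable_match_forced:
  assumes ext: "extendable G M"
    and iso: "isolated_edges G (residual G M) Q"
  shows "extendable G (M \<union> match_forced (residual G M) Q)"
proof -
  define H where "H = residual G M"
  define M' where "M' = M \<union> match_forced H Q"
  define H' where "H' = residual G M'"
  interpret residual_forest G H
    by unfold_locales (auto simp: H_def residual_def intro: sym_residual[OF symG, unfolded residual_def])
  have M: "M \<subseteq> G" "sym M" "single_valued M"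
    "\<And>x u. x \<notin> Domain M \<Longrightarrow> \<exists>w. (x, w) \<in> H \<and> w \<noteq> u" "wf ((forced H)\<inverse>)"
    using ext unfolding extendable_def H_def by blast+
  have QH: "e \<in> H" if "e \<in> Q" for e using iso that unfolding isolated_edges_def H_def by blast
  have far: "e = e'" if "e \<in> Q" "e' \<in> Q" "u \<in> Field (nearby_edges H e)" "u' \<in> Field (nearby_edges H e')"
    "(u, u') \<in> G\<^sup>= O G\<^sup>=" for e e' u u'
    using iso that unfolding isolated_edges_def H_def by blast
  have Field_nearby: "u \<in> Field (nearby_edges H e)" if "u \<in> Field (forced_edges H e)" for u e
    using that mono_Field[OF forced_edges_subset_nearby, of H e] by blast
  have Field_alive: "u \<notin> Domain M" if "u \<in> Field (forced_edges H e)" "e \<in> Q" for u e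
    using forced_edges_subset[OF symH QH[OF that(2)]] that(1)
    by (auto simp: Field_def H_def residual_def)
  have Domain_M': "u \<in> Domain M' \<longleftrightarrow> u \<in> Domain M \<or> (\<exists>e\<in>Q. u \<in> Field (forced_edges H e))" for u
    by (auto simp: M'_def match_forced_def Field_def)
  have H'_sub: "H' \<subseteq> H"
    by (auto simp: H'_def H_def residual_def M'_def)
  have H'_iff: "(x, y) \<in> H' \<longleftrightarrow> (x, y) \<in> H \<and> x \<notin> Domain M' \<and> y \<notin> Domain M'" for x y
    by (auto simp: H'_def H_def residual_def Domain_M')
  have lost: "\<exists>e\<in>Q. \<exists>p. (p, u) \<in> forced_edges H e \<and> v \<notin> Field (forced_edges H e)"
    if vu: "(v, u) \<in> H" "v \<notin> Domain M'" "u \<in> Domain M'" for u v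
  proof -
    have "u \<notin> Domain M" using vu(1) by (auto simp: H_def residual_def)
    then obtain e where e: "e \<in> Q" "u \<in> Field (forced_edges H e)" using vu(3) Domain_M' by blast
    moreover have "v \<notin> Field (forced_edges H e)" using e(1) vu(2) Domain_M' by blast
    moreover have "(u, v) \<in> H" using vu(1) symH by (auto dest: symD)
    ultimately show ?thesis using boundary_of_forced_edges[OF QH[OF e(1)] e(2)] by blast
  qed
  have lost_unique: "u = u'"
    if vu: "(v, u) \<in> H" "(v, u') \<in> H" "v \<notin> Domain M'" "u \<in> Domain M'" "u' \<in> Domain M'" for u u' v
  proof -
    obtain e p where e: "e \<in> Q" "(p, u) \<in> forced_edges H e" "v \<notin> Field (forced_edges H e)"
      using lost[OF vu(1,3,4)] by blast
    obtain e' p' where e': "e' \<in> Q" "(p', u') \<in> forced_edges H e'" "v \<notin> Field (forced_edges H e')"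
      using lost[OF vu(2,3,5)] by blast
    have uv: "(u, v) \<in> H" "(u', v) \<in> H" using vu(1,2) symH by (auto dest: symD)
    then have "(u, u') \<in> G\<^sup>= O G\<^sup>=" using vu(2) subH by blast
    moreover have "u \<in> Field (nearby_edges H e)" "u' \<in> Field (nearby_edges H e')"
      by (rule Field_nearby[OF FieldI2[OF e(2)]], rule Field_nearby[OF FieldI2[OF e'(2)]])
    ultimately have "e = e'" using far e(1) e'(1) by blast
    obtain zs zs' where "rooted e (v # u # p # zs)" "rooted e (v # u' # p' # zs')"
      using boundary_rooted[OF QH[OF e(1)] e(2,3) uv(1)] boundary_rooted[OF QH[OF e'(1)] e'(2,3) uv(2)]
        \<open>e = e'\<close> by blast
    then show ?thesis using rooted_unique[of e "v # u # p # zs" "v # u' # p' # zs'"] by simp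
  qed
  have "M' \<subseteq> G"
    using M(1) forced_edges_subset[OF symH QH] subH symG
    by (fastforce simp: M'_def match_forced_def dest: symD)
  moreover have "sym M'"
    using M(2) by (auto simp: M'_def match_forced_def sym_def)
  moreover have "single_valued M'"
  proof (rule single_valuedI)
    fix a b b' assume ab: "(a, b) \<in> M'" "(a, b') \<in> M'"
    have piece: "\<exists>e\<in>Q. (a, b) \<in> forced_edges H e \<union> (forced_edges H e)\<inverse> \<and> a \<in> Field (forced_edges H e)"
      if "(a, b) \<in> M'" "(a, b) \<notin> M" for a b
      using that by (auto simp: M'_def match_forced_def Field_def)
    show "b = b'"
    proof (cases "a \<in> Domain M")
      case True
      then have "(a, b) \<in> M" "(a, b') \<in> M" using piece ab Field_alive by blast+
      then show ?thesis using M(3) by (auto dest: single_valuedD)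
    next
      case False
      then obtain e e' where e: "e \<in> Q" "(a, b) \<in> forced_edges H e \<union> (forced_edges H e)\<inverse>" "a \<in> Field (forced_edges H e)"
        and e': "e' \<in> Q" "(a, b') \<in> forced_edges H e' \<union> (forced_edges H e')\<inverse>" "a \<in> Field (forced_edges H e')"
        using piece[OF ab(1)] piece[OF ab(2)] by blast
      then have "e = e'" using far Field_nearby by blast
      then show ?thesis
        using single_valuedD[OF single_valued_forced_edges[OF QH[OF e(1)]]] e(2) e'(2) by blast
    qed
  qed
  moreover have "\<exists>w. (x, w) \<in> H' \<and> w \<noteq> u0" if x: "x \<notin> Domain M'" for x u0
  proof (rule ccontr)
    assume none: "\<nexists>w. (x, w) \<in> H' \<and> w \<noteq> u0"
    have "x \<notin> Domain M" using x Domain_M' by blast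
    then obtain u where u: "(x, u) \<in> H" "u \<noteq> u0" using M(4) by blast
    then have "u \<in> Domain M'" using none x H'_iff by blast
    obtain w where w: "(x, w) \<in> H" "w \<noteq> u" using M(4) \<open>x \<notin> Domain M\<close> by blast
    have only: "y = u \<or> y = u0" if "(x, y) \<in> H" for y
      using lost_unique[OF u(1) that x \<open>u \<in> Domain M'\<close>] none x H'_iff that by blast
    then have "w = u0" using w by blast
    obtain e p where e: "e \<in> Q" "(p, u) \<in> forced_edges H e" "x \<notin> Field (forced_edges H e)"
      using lost[OF u(1) x \<open>u \<in> Domain M'\<close>] by blast
    have "(p, u) \<in> H" using forced_edges_subset[OF symH QH[OF e(1)]] e(2) by blast
    moreover have "x \<noteq> p" using e(2,3) by (auto simp: Field_def)
    ultimately have "((p, u), (x, u0)) \<in> forced H"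
      using u w only \<open>w = u0\<close> symH by (auto simp: forced_def two_step_def dest: symD)
    then have "x \<in> Field (forced_edges H e)"
      using forced_edges_step[OF e(2)] by (auto simp: Field_def)
    then show False using e(3) by blast
  qed
  moreover have "wf ((forced H')\<inverse>)"
    unfolding wf_iff_no_infinite_down_chain
  proof
    assume "\<exists>f. \<forall>i. (f (Suc i), f i) \<in> (forced H')\<inverse>"
    then obtain f where f: "\<And>i. (f i, f (Suc i)) \<in> forced H'" by blast
    define new where "new i \<longleftrightarrow> (f i, f (Suc i)) \<notin> forced H" for i
    have H'_edges: "(snd (f i), fst (f (Suc i))) \<in> H'" "fst (f (Suc i)) \<noteq> fst (f i)"
      "(fst (f (Suc i)), snd (f (Suc i))) \<in> H'" "snd (f (Suc i)) \<noteq> snd (f i)" for i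
      using f[of i] by (auto simp: forced_def two_step_def)
    \<comment> \<open>A move becomes forced only because a third neighbour has been covered.\<close>
    have new: "\<exists>e\<in>Q. \<exists>p u. (p, u) \<in> forced_edges H e \<and> (fst (f (Suc i)), u) \<in> H \<and> u \<in> Domain M' \<and>
        fst (f (Suc i)) \<notin> Field (forced_edges H e)" if new_i: "new i" for i
    proof -
      have "(f i, f (Suc i)) \<in> two_step H"
        using f[of i] forced_subset_two_step two_step_mono[OF H'_sub] by blast
      then obtain u where u: "(fst (f (Suc i)), u) \<in> H" "u \<noteq> snd (f i)" "u \<noteq> snd (f (Suc i))"
        using new_i by (cases "f i"; cases "f (Suc i)") (auto simp: new_def forced_def)
      have "(fst (f (Suc i)), u) \<notin> H'"
        using f[of i] u(2,3) by (auto simp: forced_def)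
      moreover have alive: "fst (f (Suc i)) \<notin> Domain M'" using H'_edges H'_iff by blast
      ultimately have "u \<in> Domain M'" using u(1) H'_iff by blast
      then show ?thesis using lost[OF u(1) alive] u(1) by blast
    qed
    have infinite: "\<exists>i\<ge>k. new i" for k
    proof (rule ccontr)
      assume "\<not> (\<exists>i\<ge>k. new i)"
      then have "(f (k + i), f (k + Suc i)) \<in> forced H" for i by (auto simp: new_def)
      then show False
        using M(5) unfolding wf_iff_no_infinite_down_chain
        by (auto dest!: spec[of _ "\<lambda>i. f (k + i)"])
    qed
    obtain i where i: "new i" using infinite[of 0] by blast
    define j where "j = (LEAST j. Suc i \<le> j \<and> new j)"
    have j: "Suc i \<le> j" "new j"
      using LeastI_ex[OF infinite[of "Suc i"]] by (auto simp: j_def)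
    have old: "\<not> new k" if "Suc i \<le> k" "k < j" for k
      using not_less_Least[of k "\<lambda>j. Suc i \<le> j \<and> new j"] that by (auto simp: j_def)
    have reach: "k \<le> j \<Longrightarrow> (f (Suc i), f k) \<in> (forced H)\<^sup>*" if "Suc i \<le> k" for k
      using that
    proof (induction rule: dec_induct)
      case (step k)
      then show ?case using old[of k] by (auto simp: new_def intro: rtrancl_into_rtrancl)
    qed simp
    obtain e p u where e: "e \<in> Q" "(p, u) \<in> forced_edges H e" "(fst (f (Suc i)), u) \<in> H"
      "u \<in> Domain M'" "fst (f (Suc i)) \<notin> Field (forced_edges H e)"
      using new[OF i] by blast
    have "((p, u), f (Suc i)) \<in> two_step H"
    proof -
      have "(p, u) \<in> H" using forced_edges_subset[OF symH QH[OF e(1)]] e(2) by blast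
      moreover have "fst (f (Suc i)) \<noteq> p" using e(2,5) by (auto simp: Field_def)
      moreover have "snd (f (Suc i)) \<noteq> u" using H'_edges(3) H'_iff e(4) by blast
      moreover have "(fst (f (Suc i)), snd (f (Suc i))) \<in> H" using H'_edges(3) H'_sub by blast
      ultimately show ?thesis
        using e(3) symH by (cases "f (Suc i)") (auto simp: two_step_def dest: symD)
    qed
    then have near: "f j \<in> nearby_edges H e"
      unfolding nearby_edges_def using e(2) reach[OF j(1) order_refl] by blast
    obtain e' p' u' where e': "e' \<in> Q" "(p', u') \<in> forced_edges H e'" "(fst (f (Suc j)), u') \<in> H"
      "u' \<in> Domain M'" "fst (f (Suc j)) \<notin> Field (forced_edges H e')"
      using new[OF j(2)] by blast
    have adj: "(snd (f j), fst (f (Suc j))) \<in> G" using H'_edges(1)[of j] H'_sub subH by blast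
    then have "(snd (f j), u') \<in> G\<^sup>= O G\<^sup>=" using e'(3) subH by blast
    moreover have "snd (f j) \<in> Field (nearby_edges H e)"
      using near by (cases "f j") (auto simp: Field_def)
    moreover have "u' \<in> Field (nearby_edges H e')"
      using FieldI2[OF e'(2)] by (rule Field_nearby)
    ultimately have "e = e'" using far e(1) e'(1) by blast
    obtain zs where "rooted e (snd (f j) # fst (f j) # zs)"
      using nearby_edges_rooted[OF QH[OF e(1)] near] by blast
    then have "rooted e (fst (f (Suc j)) # snd (f j) # fst (f j) # zs)"
      using adj H'_edges(2)[of j] symG by (intro rooted_Cons) (auto dest: symD)
    moreover obtain zs' where "rooted e (fst (f (Suc j)) # u' # p' # zs')"
      using boundary_rooted[OF QH[OF e'(1)] e'(2,5)] e'(3) symH \<open>e = e'\<close> by (auto dest: symD)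
    ultimately have "snd (f j) = u'" using rooted_unique by fastforce
    moreover have "snd (f j) \<notin> Domain M'" using H'_edges(1) H'_iff by blast
    ultimately show False using e'(4) by blast
  qed
  ultimately show ?thesis
    unfolding extendable_def H'_def M'_def H_def by blast
qed

lemma nonbacktracking_ray_inj:
  assumes "\<And>n. (r n, r (Suc n)) \<in> G" "\<And>n. r n \<noteq> r (Suc (Suc n))"
  shows "inj r"
proof -
  have nb: "nonbacktracking G (map r (rev [0..<Suc n]))" for n
  proof (induction n)
    case (Suc n)
    have "(r (Suc n), r n) \<in> G" using assms(1) symG by (auto dest: symD)
    then show ?case
      using Suc assms(2)[of "n - 1"] by (cases n) auto
  qed simp
  show ?thesis
  proof (rule injI)
    fix m n assume "r m = r n"
    have "distinct (map r (rev [0..<Suc (max m n)]))" by (rule nonbacktracking_distinct[OF nb])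
    then have "inj_on r {..max m n}" by (simp add: distinct_map lessThan_Suc_atMost atLeast0LessThan del: upt_Suc)
    then show "m = n" using \<open>r m = r n\<close> by (auto dest: inj_onD)
  qed
qed

text \<open>An infinite run of forced moves is an injective ray whose even vertices have exactly two neighbours.\<close>

lemma extendable_empty:
  assumes degree: "degree_at_least 2 G"
    and no_ray: "\<not> (\<exists>x. graph_ray G x \<and> inj x \<and> degree_two_on_even G x)"
  shows "extendable G {}"
proof -
  have res: "residual G {} = G" by (auto simp: residual_def)
  have "\<exists>w. (x, w) \<in> G \<and> w \<noteq> u" for x u
  proof (rule ccontr)
    assume "\<nexists>w. (x, w) \<in> G \<and> w \<noteq> u"
    then have sub: "{w. (w, x) \<in> G} \<subseteq> {u}" using symG by (auto dest: symD)
    then have "finite {w. (w, x) \<in> G}" by (rule finite_subset) simp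
    moreover have "card {w. (w, x) \<in> G} \<le> 1" using card_mono[OF _ sub] by simp
    moreover have "enat 2 \<le> graph_degree G x" using degree by (auto simp: degree_at_least_def)
    ultimately show False by (simp add: graph_degree_def)
  qed
  moreover have "wf ((forced G)\<inverse>)"
    unfolding wf_iff_no_infinite_down_chain
  proof
    assume "\<exists>f. \<forall>i. (f (Suc i), f i) \<in> (forced G)\<inverse>"
    then obtain f where f: "\<And>i. (f i, f (Suc i)) \<in> forced G" by blast
    define r where "r n = (if even n then fst (f (Suc (n div 2))) else snd (f (Suc (n div 2))))" for n
    have edges: "(snd (f i), fst (f (Suc i))) \<in> G" "fst (f (Suc i)) \<noteq> fst (f i)"
      "(fst (f (Suc i)), snd (f (Suc i))) \<in> G" "snd (f (Suc i)) \<noteq> snd (f i)"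
      "\<And>u. (fst (f (Suc i)), u) \<in> G \<Longrightarrow> u = snd (f i) \<or> u = snd (f (Suc i))" for i
      using f[of i] by (auto simp: forced_def two_step_def)
    have r_step: "(r n, r (Suc n)) \<in> G \<and> r n \<noteq> r (Suc (Suc n))" for n
      using edges[of "n div 2"] edges(1-4)[of "Suc (n div 2)"]
      by (cases "even n") (auto simp: r_def)
    then have "graph_ray G r" "inj r"
      using nonbacktracking_ray_inj by (auto simp: graph_ray_def)
    moreover have "degree_two_on_even G r"
      unfolding degree_two_on_even_def
    proof
      fix n
      have "{x. (x, r (2 * n)) \<in> G} = {snd (f n), snd (f (Suc n))}"
        using edges[of n] symD[OF symG edges(3)[of n]] symG by (auto simp: r_def dest: symD)
      moreover have "card {snd (f n), snd (f (Suc n))} = 2" using edges(4)[of n] by simp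
      ultimately show "graph_degree G (r (2 * n)) = 2"
        by (simp add: graph_degree_def numeral_eq_enat)
    qed
    ultimately show False using no_ray by blast
  qed
  ultimately show ?thesis
    unfolding extendable_def res by (auto simp: sym_def)
qed

end

section \<open>Countably many Borel extensions of a Borel matching\<close>

locale borel_forest = forest G for G :: "('a::polish_space \<times> 'a) set" +
  assumes borelG: "G \<in> sets borel" and finite_neighbours: "finite (G `` {x})"
begin

lemma enumerableG: "borel_enumerable G"
  using enumerable_if_finite_sections[OF borelG] finite_neighbours by blast

lemma borel_component: "G\<^sup>* \<in> sets borel"
  and enumerable_component: "borel_enumerable (G\<^sup>*)"
  using borel_rtrancl[OF borelG enumerableG] borel_enumerable_rtrancl[OF borelG enumerableG] by auto

lemma sym_component: "(x, y) \<in> G\<^sup>* \<Longrightarrow> (y, x) \<in> G\<^sup>*"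
  using sym_rtrancl[OF symG] by (rule symD)

lemma G_component: "(x, y) \<in> G \<Longrightarrow> (x, y) \<in> G\<^sup>*"
  by blast

definition ball_relation :: "nat \<Rightarrow> ('a \<times> 'a) set" where
  "ball_relation r = (G\<^sup>=) ^^ r"

lemma sym_ball_relation: "(x, y) \<in> ball_relation r \<Longrightarrow> (y, x) \<in> ball_relation r"
proof -
  have "sym (G\<^sup>=)" using symG by (auto simp: sym_def)
  then have "sym ((G\<^sup>=) ^^ r)"
  proof (induction r)
    case (Suc r)
    have "((G\<^sup>=) ^^ Suc r)\<inverse> = (G\<^sup>=)\<inverse> O ((G\<^sup>=) ^^ r)\<inverse>"
      by (simp only: relpow.simps(2) converse_relcomp)
    also have "\<dots> = G\<^sup>= O (G\<^sup>=) ^^ r"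
      using Suc \<open>sym (G\<^sup>=)\<close> by (simp only: sym_conv_converse_eq)
    also have "\<dots> = (G\<^sup>=) ^^ Suc r" by (simp only: relpow_commute relpow.simps(2))
    finally show ?case by (simp only: sym_conv_converse_eq)
  qed (simp add: sym_Id)
  then show "(x, y) \<in> ball_relation r \<Longrightarrow> (y, x) \<in> ball_relation r"
    unfolding ball_relation_def by (rule symD)
qed

lemma borel_reflcl: "G\<^sup>= \<in> sets borel" and enumerable_reflcl: "borel_enumerable (G\<^sup>=)"
  using borelG borel_Id enumerableG borel_enumerable_Id by (auto intro: borel_enumerable_Un)

lemma borel_ball_relation: "ball_relation r \<in> sets borel"
  and enumerable_ball_relation: "borel_enumerable (ball_relation r)"
  unfolding ball_relation_def
  using borel_relpow[OF borel_reflcl enumerable_reflcl]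
    borel_enumerable_relpow[OF borel_reflcl enumerable_reflcl] by auto

lemma finite_ball: "finite (ball_relation r `` {x})"
  unfolding ball_relation_def
proof (induction r)
  case (Suc r)
  have "((G\<^sup>=) ^^ Suc r) `` {x} = G\<^sup>= `` (((G\<^sup>=) ^^ r) `` {x})"
    by (simp only: relpow.simps(2) relcomp_Image)
  moreover have "finite (G\<^sup>= `` {y})" for y
  proof -
    have "G\<^sup>= `` {y} = insert y (G `` {y})" by blast
    then show ?thesis by (simp only: finite_insert finite_neighbours)
  qed
  then have "finite (G\<^sup>= `` (((G\<^sup>=) ^^ r) `` {x}))"
    by (rule finite_Image_pointwise[OF Suc])
  ultimately show ?case by (simp only:)
qed simp

lemma finite_subset_ball:
  assumes "finite A" "\<And>u. u \<in> A \<Longrightarrow> (x, u) \<in> G\<^sup>*"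
  shows "\<exists>r. \<forall>u\<in>A. (x, u) \<in> ball_relation r"
  using assms
proof (induction A rule: finite_induct)
  case (insert v A)
  then obtain r where r: "\<forall>u\<in>A. (x, u) \<in> ball_relation r" by auto
  obtain s where s: "(x, v) \<in> ball_relation s"
    using insert.prems[of v] unfolding ball_relation_def rtrancl_eq_UN_relpow_reflcl[of G] by blast
  have "ball_relation r \<subseteq> ball_relation (max r s)" "ball_relation s \<subseteq> ball_relation (max r s)"
    unfolding ball_relation_def by (intro relpow_reflcl_mono; simp)+
  then show ?case using r s by blast
qed simp

text \<open>All relations between edges that occur below are contained in this one, so that
  \<open>enumerable_same_component\<close> makes their compositions and domains Borel.\<close>

definition same_component :: "(('a \<times> 'a) \<times> ('a \<times> 'a)) set" where
  "same_component = {((p, v), (z, w)). (p, v) \<in> G\<^sup>* \<and> (p, z) \<in> G\<^sup>* \<and> (p, w) \<in> G\<^sup>*}"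

lemma enumerable_same_component: "borel_enumerable same_component"
proof -
  obtain h :: "nat \<Rightarrow> 'a \<Rightarrow> 'a" where h: "\<And>n. h n \<in> borel_measurable borel"
    "\<And>x y. (x, y) \<in> G\<^sup>* \<Longrightarrow> \<exists>n. y = h n x"
    using enumerable_component unfolding borel_enumerable_def by blast
  show ?thesis
  proof (rule borel_enumerableI[of "\<lambda>(m, n) (e :: 'a \<times> 'a). (h m (fst e), h n (fst e))"])
    fix c :: "nat \<times> nat"
    have "(\<lambda>e :: 'a \<times> 'a. (h m (fst e), h n (fst e))) \<in> borel_measurable borel" for m n
      by (intro borel_measurable_Pair measurable_compose[OF borel_measurable_projections(1) h(1)])
    then show "(case c of (m, n) \<Rightarrow> \<lambda>e :: 'a \<times> 'a. (h m (fst e), h n (fst e))) \<in> borel_measurable borel"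
      by (cases c) (simp only: prod.case)
  next
    fix e e' assume "(e, e') \<in> same_component"
    then have "(fst e, fst e') \<in> G\<^sup>*" "(fst e, snd e') \<in> G\<^sup>*"
      by (auto simp: same_component_def)
    then obtain m n where "fst e' = h m (fst e)" "snd e' = h n (fst e)" using h(2) by blast
    then show "\<exists>c. e' = (case c of (m, n) \<Rightarrow> \<lambda>e :: 'a \<times> 'a. (h m (fst e), h n (fst e))) e"
      by (intro exI[of _ "(m, n)"]) (simp add: prod_eq_iff)
  qed
qed

lemma trans_same_component:
  "(e, e') \<in> same_component \<Longrightarrow> (e', e'') \<in> same_component \<Longrightarrow> (e, e'') \<in> same_component"
  by (cases e; cases e'; cases e'') (auto simp: same_component_def intro: rtrancl_trans)

lemma same_component_relcomp:
  "R \<subseteq> same_component \<Longrightarrow> S \<subseteq> same_component\<^sup>= \<Longrightarrow> R O S \<subseteq> same_component"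
  "R \<subseteq> same_component\<^sup>= \<Longrightarrow> S \<subseteq> same_component\<^sup>= \<Longrightarrow> R O S \<subseteq> same_component\<^sup>="
  using trans_same_component by fast+

lemma sym_same_component: "(e, e') \<in> same_component \<Longrightarrow> (e', e) \<in> same_component"
  by (cases e; cases e') (auto simp: same_component_def intro: rtrancl_trans sym_component)

lemma two_step_same_component: "H \<subseteq> G \<Longrightarrow> two_step H \<subseteq> same_component"
proof clarify
  fix p v z w assume "H \<subseteq> G" "((p, v), (z, w)) \<in> two_step H"
  then have "(p, v) \<in> G\<^sup>*" "(v, z) \<in> G\<^sup>*" "(z, w) \<in> G\<^sup>*"
    by (auto simp: two_step_def intro!: G_component)
  moreover from this have "(p, z) \<in> G\<^sup>*" "(p, w) \<in> G\<^sup>*"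
    by (meson rtrancl_trans)+
  ultimately show "((p, v), (z, w)) \<in> same_component"
    by (simp add: same_component_def)
qed

lemma borel_two_step:
  fixes H :: "('a \<times> 'a) set"
  assumes "H \<in> sets borel"
  shows "two_step H \<in> sets borel"
proof -
  have "{q :: ('a \<times> 'a) \<times> ('a \<times> 'a). (fst (fst q), snd (fst q)) \<in> H \<and> (snd (fst q), fst (snd q)) \<in> H \<and>
      \<not> fst (snd q) = fst (fst q) \<and> (fst (snd q), snd (snd q)) \<in> H \<and> \<not> snd (snd q) = snd (fst q)}
    \<in> sets borel" (is "?S \<in> _")
    by (intro borel_Collect borel_pred_intros assms)
  moreover have "two_step H = ?S" by (auto simp: two_step_def)
  ultimately show ?thesis by simp
qed

lemma borel_forced:
  assumes "H \<in> sets borel" "H \<subseteq> G"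
  shows "forced H \<in> sets borel"
proof -
  obtain h :: "nat \<Rightarrow> 'a \<Rightarrow> 'a" where h: "\<And>n. h n \<in> borel_measurable borel"
    "\<And>x y. (x, y) \<in> G \<Longrightarrow> \<exists>n. y = h n x"
    using enumerableG unfolding borel_enumerable_def by blast
  have h': "(\<lambda>q :: ('a \<times> 'a) \<times> ('a \<times> 'a). h n (fst (snd q))) \<in> borel_measurable borel" for n
    by (rule measurable_compose[OF _ h(1)]) (intro borel_pred_intros)
  have "{q :: ('a \<times> 'a) \<times> ('a \<times> 'a). \<forall>n. (fst (snd q), h n (fst (snd q))) \<in> H \<longrightarrow>
      h n (fst (snd q)) = snd (fst q) \<or> h n (fst (snd q)) = snd (snd q)} \<in> sets borel" (is "?S \<in> _")
    by (intro borel_Collect borel_pred_intros assms h')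
  moreover have "forced H = two_step H \<inter> ?S"
  proof -
    have "(\<forall>u. (z, u) \<in> H \<longrightarrow> u = v \<or> u = w) \<longleftrightarrow>
        (\<forall>n. (z, h n z) \<in> H \<longrightarrow> h n z = v \<or> h n z = w)" for z v w
      using h(2) assms(2) by blast
    then show ?thesis by (auto simp: forced_def)
  qed
  ultimately show ?thesis using borel_two_step[OF assms(1)] by simp
qed

definition orientations :: "('a \<times> 'a) set \<Rightarrow> (('a \<times> 'a) \<times> ('a \<times> 'a)) set" where
  "orientations Q = {(e, e'). e \<in> Q \<and> (e' = e \<or> e' = prod.swap e)}"

lemma borel_orientations:
  assumes "Q \<in> sets borel"
  shows "orientations Q \<in> sets borel"
proof -
  have "{q :: ('a \<times> 'a) \<times> ('a \<times> 'a). (fst (fst q), snd (fst q)) \<in> Q \<and>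
      (snd q = fst q \<or> snd q = (snd (fst q), fst (fst q)))} \<in> sets borel" (is "?S \<in> _")
    by (intro borel_Collect borel_pred_intros assms)
  moreover have "orientations Q = ?S" by (auto simp: orientations_def)
  ultimately show ?thesis by simp
qed

lemma orientations_same_component: "Q \<subseteq> G \<Longrightarrow> orientations Q \<subseteq> same_component"
  by (auto simp: orientations_def same_component_def dest: G_component)

lemma forced_rtrancl:
  assumes "H \<in> sets borel" "H \<subseteq> G"
  shows "(forced H)\<^sup>* \<in> sets borel" "borel_enumerable ((forced H)\<^sup>*)"
    "(forced H)\<^sup>* \<subseteq> same_component\<^sup>="
proof -
  have sub: "forced H \<subseteq> same_component"
    using forced_subset_two_step two_step_same_component[OF assms(2)] by blast
  then have "borel_enumerable (forced H)" using borel_enumerable_subset enumerable_same_component by blast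
  then show "(forced H)\<^sup>* \<in> sets borel" "borel_enumerable ((forced H)\<^sup>*)"
    using borel_rtrancl borel_enumerable_rtrancl borel_forced[OF assms] by blast+
  have "trans same_component" using trans_same_component by (rule transI)
  then have "same_component\<^sup>* = same_component\<^sup>=" by (simp add: rtrancl_trancl_reflcl)
  then show "(forced H)\<^sup>* \<subseteq> same_component\<^sup>=" using rtrancl_mono[OF sub] by simp
qed

lemma borel_match_forced:
  assumes "H \<in> sets borel" "H \<subseteq> G" "Q \<in> sets borel" "Q \<subseteq> H"
  shows "match_forced H Q \<in> sets borel"
proof -
  define K where "K = orientations Q O (forced H)\<^sup>*"
  have QG: "Q \<subseteq> G" using assms(2,4) by blast
  have "K \<in> sets borel"
    unfolding K_def
    using borel_enumerable_subset[OF enumerable_same_component orientations_same_component[OF QG]]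
    by (intro borel_relcomp borel_orientations assms forced_rtrancl)
  then have conv: "K\<inverse> \<in> sets borel" by (rule borel_converse)
  have "K \<subseteq> same_component"
    unfolding K_def
    by (intro same_component_relcomp orientations_same_component QG forced_rtrancl assms(1,2))
  then have "K\<inverse> \<subseteq> same_component" using sym_same_component by blast
  then have "borel_enumerable (K\<inverse>)" using borel_enumerable_subset enumerable_same_component by blast
  then have "Domain (K\<inverse>) \<in> sets borel" using conv borel_Domain by blast
  moreover have "Domain (K\<inverse>) = (\<Union>e\<in>Q. forced_edges H e)"
    by (auto simp: K_def orientations_def forced_edges_def)
  ultimately have "(\<Union>e\<in>Q. forced_edges H e) \<in> sets borel" by (simp only:)
  then have "(\<Union>e\<in>Q. forced_edges H e) \<union> (\<Union>e\<in>Q. forced_edges H e)\<inverse> \<in> sets borel"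
    by (intro sets.Un borel_converse)
  moreover have "match_forced H Q = (\<Union>e\<in>Q. forced_edges H e) \<union> (\<Union>e\<in>Q. forced_edges H e)\<inverse>"
    by (auto simp: match_forced_def)
  ultimately show ?thesis by (simp only:)
qed

lemma nearby_relation:
  assumes "H \<in> sets borel" "H \<subseteq> G"
  defines "N \<equiv> {(e, e'). e \<in> H \<and> e' \<in> nearby_edges H e}"
  shows "N \<in> sets borel" "N \<subseteq> same_component"
proof -
  have N: "N = orientations H O (forced H)\<^sup>* O (two_step H)\<^sup>= O (forced H)\<^sup>*"
    unfolding N_def nearby_edges_def forced_edges_def orientations_def by blast
  have two: "two_step H \<subseteq> same_component" "orientations H \<subseteq> same_component"
    using two_step_same_component orientations_same_component assms(2) by blast+
  then have "borel_enumerable (two_step H)" "borel_enumerable (orientations H)"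
    using borel_enumerable_subset enumerable_same_component by blast+
  then show "N \<in> sets borel"
    unfolding N
    by (intro borel_relcomp sets.Un borel_orientations forced_rtrancl borel_two_step borel_Id assms(1,2)
        borel_enumerable_Un borel_enumerable_Id)
  show "N \<subseteq> same_component"
    unfolding N using two
    by (intro same_component_relcomp forced_rtrancl assms(1,2)) auto
qed

text \<open>The function \<open>g\<close> selects one edge at each vertex, and the set \<open>B\<close> thins out the vertices so that the
  balls of radius \<open>r\<close> around them are more than distance two apart.\<close>

definition scattered_edges :: "('a \<times> 'a) set \<Rightarrow> ('a \<Rightarrow> 'a) \<Rightarrow> 'a set \<Rightarrow> nat \<Rightarrow> ('a \<times> 'a) set" where
  "scattered_edges H g B r = {e \<in> H. snd e = g (fst e) \<and> fst e \<in> B \<and>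
    (\<forall>x'. (fst e, x') \<in> ball_relation (r + 2 + r) \<longrightarrow> x' \<in> B \<longrightarrow> x' = fst e) \<and>
    (\<forall>e'\<in>nearby_edges H e. (fst e, fst e') \<in> ball_relation r \<and> (fst e, snd e') \<in> ball_relation r)}"

lemma borel_scattered_edges:
  assumes "H \<in> sets borel" "H \<subseteq> G" "g \<in> borel_measurable borel" "B \<in> sets borel"
  shows "scattered_edges H g B r \<in> sets borel"
proof -
  define N where "N = {(e, e'). e \<in> H \<and> e' \<in> nearby_edges H e}"
  note N = nearby_relation[OF assms(1,2), folded N_def]
  define crowded where "crowded = {p \<in> ball_relation (r + 2 + r). snd p \<in> B \<and> snd p \<noteq> fst p}"
  have "{p. (fst p, snd p) \<in> ball_relation (r + 2 + r) \<and> snd p \<in> B \<and> \<not> snd p = fst p} \<in> sets borel"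
    by (intro borel_Collect borel_pred_intros borel_ball_relation pred_sets2[OF assms(4)])
  then have "crowded \<in> sets borel" by (simp add: crowded_def)
  moreover have "borel_enumerable crowded"
    using borel_enumerable_subset[OF enumerable_ball_relation[of "r + 2 + r"]] by (auto simp: crowded_def)
  ultimately have crowded: "Domain crowded \<in> sets borel" by (rule borel_Domain)
  define escaping where "escaping = {q. q \<in> N \<and>
      \<not> ((fst (fst q), fst (snd q)) \<in> ball_relation r \<and> (fst (fst q), snd (snd q)) \<in> ball_relation r)}"
  have "escaping \<in> sets borel"
    unfolding escaping_def
    by (intro borel_Collect borel_pred_intros borel_ball_relation pred_sets2[OF N(1)])
  moreover have "borel_enumerable escaping"
    by (rule borel_enumerable_subset[OF enumerable_same_component]) (use N(2) in \<open>auto simp: escaping_def\<close>)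
  ultimately have escaping: "Domain escaping \<in> sets borel" by (rule borel_Domain)
  have g: "(\<lambda>e :: 'a \<times> 'a. g (fst e)) \<in> borel_measurable borel"
    by (rule measurable_compose[OF borel_measurable_projections(1) assms(3)])
  have "{e. e \<in> H \<and> snd e = g (fst e) \<and> fst e \<in> B \<and> \<not> fst e \<in> Domain crowded \<and> \<not> e \<in> Domain escaping}
      \<in> sets borel"
    by (intro borel_Collect borel_pred_intros g pred_sets2[OF assms(1)] pred_sets2[OF assms(4)]
        pred_sets2[OF crowded] pred_sets2[OF escaping])
  moreover have "scattered_edges H g B r =
      {e. e \<in> H \<and> snd e = g (fst e) \<and> fst e \<in> B \<and> \<not> fst e \<in> Domain crowded \<and> \<not> e \<in> Domain escaping}"
    unfolding scattered_edges_def crowded_def escaping_def N_def by fastforce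
  ultimately show ?thesis by simp
qed

lemma isolated_scattered_edges: "isolated_edges G H (scattered_edges H g B r)"
  unfolding isolated_edges_def
proof (intro conjI ballI impI)
  show "scattered_edges H g B r \<subseteq> H" by (auto simp: scattered_edges_def)
next
  fix e e' u u' assume e: "e \<in> scattered_edges H g B r" and e': "e' \<in> scattered_edges H g B r"
    and u: "u \<in> Field (nearby_edges H e)" "u' \<in> Field (nearby_edges H e')" "(u, u') \<in> G\<^sup>= O G\<^sup>="
  have near: "(fst e, u) \<in> ball_relation r"
    if e: "e \<in> scattered_edges H g B r" and u: "u \<in> Field (nearby_edges H e)" for e u
  proof -
    obtain e' where "e' \<in> nearby_edges H e" "u = fst e' \<or> u = snd e'"
      using u by (force simp: Field_def)
    then show ?thesis using e unfolding scattered_edges_def by blast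
  qed
  have "(fst e, u) \<in> ball_relation r" by (rule near[OF e u(1)])
  moreover have "(u', fst e') \<in> ball_relation r" by (rule sym_ball_relation[OF near[OF e' u(2)]])
  moreover have "(u, u') \<in> ball_relation 2"
    using u(3) by (simp add: ball_relation_def numeral_2_eq_2)
  ultimately have "(fst e, fst e') \<in> ball_relation (r + 2 + r)"
    unfolding ball_relation_def relpow_add by blast
  then have "fst e' = fst e" using e e' unfolding scattered_edges_def by blast
  then show "e = e'" using e e' by (simp add: scattered_edges_def prod_eq_iff)
qed

text \<open>The parameters are the Borel function selecting the start edge, the basic open set and the radius.  For
  a given uncovered vertex a suitable radius exists because \<open>nearby_edges\<close> is finite, and then a suitable
  basic open set exists because balls are finite.\<close>

lemma extendable_extensions:
  assumes ext: "extendable G M" and M: "M \<in> sets borel"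
  shows "\<exists>e :: nat \<Rightarrow> ('a \<times> 'a) set.
    (\<forall>c. (extendable G (e c) \<and> e c \<in> sets borel) \<and> M \<subseteq> e c) \<and> (\<Union>c. Domain (e c)) = UNIV"
proof -
  define H where "H = residual G M"
  have M_G: "M \<subseteq> G" and deg: "\<And>x u. x \<notin> Domain M \<Longrightarrow> \<exists>w. (x, w) \<in> H \<and> w \<noteq> u"
    and wf: "wf ((forced H)\<inverse>)"
    using ext unfolding extendable_def H_def by blast+
  have H_G: "H \<subseteq> G" and symH: "sym H"
    using sym_residual[OF symG] by (auto simp: H_def residual_def)
  have "Domain M \<in> sets borel"
    using M borel_enumerable_subset[OF enumerableG M_G] by (rule borel_Domain)
  then have "(- Domain M) \<times> (- Domain M) \<in> sets (borel \<Otimes>\<^sub>M borel)" by (intro pair_measureI) auto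
  then have H_borel: "H \<in> sets borel" unfolding H_def residual_def borel_prod using borelG by blast
  have finH: "finite (H `` {x})" for x
    using finite_subset[OF Image_mono[OF H_G order_refl] finite_neighbours] .
  obtain h :: "nat \<Rightarrow> 'a \<Rightarrow> 'a" where h: "\<And>n. h n \<in> borel_measurable borel"
    "\<And>x y. (x, y) \<in> G \<Longrightarrow> \<exists>n. y = h n x"
    using enumerableG unfolding borel_enumerable_def by blast
  obtain B :: "nat \<Rightarrow> 'a set" where B: "\<And>b. open (B b)" "\<And>b. B b \<noteq> {}"
    "\<And>U x. open U \<Longrightarrow> x \<in> U \<Longrightarrow> \<exists>b. x \<in> B b \<and> B b \<subseteq> U"
    by (rule open_base_sequence) (rule that)
  define Q where "Q c = (case from_nat c of (n, b, r) \<Rightarrow> scattered_edges H (h n) (B b) r)" for c :: nat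
  define e where "e c = M \<union> match_forced H (Q c)" for c
  have Q: "Q c \<in> sets borel" "isolated_edges G H (Q c)" for c
    using isolated_scattered_edges borel_scattered_edges[OF H_borel H_G h(1) borel_open[OF B(1)]]
    by (auto simp: Q_def split: prod.split)
  then have Q_H: "Q c \<subseteq> H" for c unfolding isolated_edges_def by blast
  have "extendable G (e c)" for c
    using extendable_match_forced[OF ext, folded H_def, OF Q(2)] by (simp add: e_def)
  moreover have "e c \<in> sets borel" for c
    unfolding e_def by (intro sets.Un M borel_match_forced H_borel H_G Q Q_H)
  moreover have "\<exists>c. x \<in> Domain (e c)" for x
  proof (cases "x \<in> Domain M")
    case True
    then show ?thesis by (auto simp: e_def)
  next
    case False
    then obtain y where y: "(x, y) \<in> H" using deg by blast
    then obtain n where n: "y = h n x" using H_G h(2) by blast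
    have "nearby_edges H (x, y) \<subseteq> snd ` {q \<in> same_component. fst q = (x, y)}"
      using nearby_relation(2)[OF H_borel H_G] y by force
    then have comp: "(x, fst e') \<in> G\<^sup>* \<and> (x, snd e') \<in> G\<^sup>*" if "e' \<in> nearby_edges H (x, y)" for e'
      using that by (force simp: same_component_def)
    have fin: "finite (nearby_edges H (x, y))" by (rule finite_nearby_edges[OF wf finH])
    obtain r where r: "\<forall>u\<in>fst ` nearby_edges H (x, y) \<union> snd ` nearby_edges H (x, y). (x, u) \<in> ball_relation r"
      using finite_subset_ball[of "fst ` nearby_edges H (x, y) \<union> snd ` nearby_edges H (x, y)" x] fin comp
      by blast
    have "finite (ball_relation (r + 2 + r) `` {x} - {x})" using finite_ball by blast
    then have "open (- (ball_relation (r + 2 + r) `` {x} - {x}))"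
      by (intro open_Compl finite_imp_closed)
    then obtain b where b: "x \<in> B b" "B b \<subseteq> - (ball_relation (r + 2 + r) `` {x} - {x})"
      using B(3)[of "- (ball_relation (r + 2 + r) `` {x} - {x})" x] by blast
    define c where "c = to_nat (n, b, r)"
    have "(x, y) \<in> scattered_edges H (h n) (B b) r"
      using y n b r unfolding scattered_edges_def by auto
    then have "(x, y) \<in> Q c" by (simp add: Q_def c_def)
    moreover have "(x, y) \<in> forced_edges H (x, y)" by (auto simp: forced_edges_def)
    ultimately have "(x, y) \<in> e c" by (auto simp: e_def match_forced_def)
    then show ?thesis by blast
  qed
  ultimately show ?thesis by (intro exI[of _ e]) (auto simp: e_def)
qed

end

section \<open>Borel perfect matchings on comeager invariant sets\<close>

lemma connectedness_eq_rtrancl: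
  assumes "sym G"
  shows "connectedness G = G\<^sup>*"
proof
  have "equiv UNIV (G\<^sup>*)"
    using sym_rtrancl[OF assms] by (auto intro!: equivI refl_rtrancl trans_rtrancl)
  then show "connectedness G \<subseteq> G\<^sup>*" unfolding connectedness_def by blast
  show "G\<^sup>* \<subseteq> connectedness G"
    unfolding connectedness_def
  proof (rule Inter_greatest)
    fix E assume "E \<in> {E. equiv UNIV E \<and> G \<subseteq> E}"
    then have E: "refl E" "trans E" "G \<subseteq> E" by (auto simp: equiv_def)
    then have "E\<^sup>* = E" by (metis reflcl_trancl rtrancl_trancl_reflcl trancl_id refl_on_def UNIV_I
          Un_absorb2 pair_in_Id_conv subrelI)
    then show "G\<^sup>* \<subseteq> E" using rtrancl_mono[OF E(3)] by simp
  qed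
qed

lemma graph_invariantI:
  assumes "sym G" "\<And>x y. (x, y) \<in> G\<^sup>* \<Longrightarrow> x \<in> C \<Longrightarrow> y \<in> C"
  shows "graph_invariant G C"
  unfolding graph_invariant_def connected_components_def connectedness_eq_rtrancl[OF assms(1)]
proof (intro exI conjI)
  show "(\<lambda>x. G\<^sup>* `` {x}) ` C \<subseteq> UNIV // G\<^sup>*" by (auto simp: quotient_def)
  show "C = \<Union>((\<lambda>x. G\<^sup>* `` {x}) ` C)" using assms(2) by auto
qed

text \<open>The preimage of a Borel set under the matching is the domain of a Borel relation contained in \<open>M\<close>.\<close>

lemma has_borel_perfect_matchingI:
  fixes G M :: "('a::polish_space \<times> 'a) set"
  assumes "C \<in> sets borel" "M \<in> sets borel" "borel_enumerable M"
    and "M \<subseteq> G" "sym M" "single_valued M"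
    and "\<And>x. x \<in> C \<Longrightarrow> x \<in> Domain M" "\<And>x y. (x, y) \<in> M \<Longrightarrow> x \<in> C \<Longrightarrow> y \<in> C"
  shows "has_borel_perfect_matching C (G \<inter> (C \<times> C))"
proof -
  define f where "f x = (THE y. (x, y) \<in> M)" for x
  have f: "(x, f x) \<in> M" if "x \<in> C" for x
    using assms(6,7) that unfolding f_def single_valued_def by (metis DomainE theI)
  have f_unique: "f x = y" if "(x, y) \<in> M" for x y
    using assms(6) that unfolding f_def single_valued_def by blast
  have fC: "f x \<in> C" "f (f x) = x" if "x \<in> C" for x
    using assms(8)[OF f] f_unique[OF symD[OF assms(5) f]] that by auto
  then have "bij_betw f C C" by (intro bij_betwI[of _ _ _ f]) auto
  then have "perfect_matching C (G \<inter> (C \<times> C)) C f"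
    using f fC assms(4) unfolding perfect_matching_def matching_def by auto
  moreover have "f \<in> borel_measurable (restrict_space borel C)"
  proof (rule measurableI)
    fix B :: "'a set" assume B: "B \<in> sets borel"
    have "snd -` B \<in> sets (borel :: ('a \<times> 'a) measure)"
      using measurable_sets[OF borel_measurable_projections(2) B] by simp
    then have "M \<inter> snd -` B \<in> sets borel" using assms(2) by (rule sets.Int[rotated])
    moreover have "borel_enumerable (M \<inter> snd -` B)"
      by (rule borel_enumerable_subset[OF assms(3)]) blast
    ultimately have "Domain (M \<inter> snd -` B) \<in> sets borel" by (rule borel_Domain)
    moreover have "f -` B \<inter> C = Domain (M \<inter> snd -` B) \<inter> C"
      using f f_unique by force
    ultimately show "f -` B \<inter> space (restrict_space borel C) \<in> sets (restrict_space borel C)"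
      using assms(1) by (auto simp: sets_restrict_space_iff space_restrict_space)
  qed simp
  ultimately show ?thesis
    using assms(1) unfolding has_borel_perfect_matching_def borel_partial_function_def by blast
qed

theorem theorem3:
  fixes G :: "('a::polish_space \<times> 'a) set"
  assumes "graph_on UNIV G"
    and "G \<in> sets borel"
    and "acyclic_graph G"
    and "locally_finite_graph G"
    and "degree_at_least 2 G"
    and "\<not> (\<exists>x. graph_ray G x \<and> inj x \<and> degree_two_on_even G x)"
  shows "\<exists>C. comeager C \<and> graph_invariant G C \<and> C \<in> sets borel \<and>
    has_borel_perfect_matching C (G \<inter> (C \<times> C))"
proof -
  have symG: "sym G" and "irrefl G" using assms(1) by (auto simp: graph_on_def)
  have "finite (G `` {x})" for x
  proof -
    have "finite {y. (y, x) \<in> G}"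
    proof (rule ccontr)
      assume "\<not> finite {y. (y, x) \<in> G}"
      then have "graph_degree G x = \<infinity>" by (simp add: graph_degree_def)
      then show False using assms(4) unfolding locally_finite_graph_def by (metis less_irrefl)
    qed
    moreover have "G `` {x} = {y. (y, x) \<in> G}" using symG by (auto dest: symD)
    ultimately show ?thesis by simp
  qed
  then interpret borel_forest G
    using symG \<open>irrefl G\<close> assms(2,3) by unfold_locales
  obtain h :: "nat \<Rightarrow> 'a \<Rightarrow> 'a" where h: "\<And>n. h n \<in> borel_measurable borel"
    "\<And>x y. (x, y) \<in> G\<^sup>* \<Longrightarrow> \<exists>n. y = h n x"
    using enumerable_component unfolding borel_enumerable_def by blast
  have start: "extendable G {} \<and> {} \<in> sets borel"
    using extendable_empty[OF assms(5,6)] by simp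
  have Domain_borel: "Domain M \<in> sets borel" if "extendable G M \<and> M \<in> sets borel" for M
  proof (rule borel_Domain)
    show "borel_enumerable M"
      using that borel_enumerable_subset[OF enumerableG] unfolding extendable_def by blast
  qed (use that in simp)
  have extensions: "\<exists>e :: nat \<Rightarrow> ('a \<times> 'a) set.
      (\<forall>c. (extendable G (e c) \<and> e c \<in> sets borel) \<and> M \<subseteq> e c) \<and> (\<Union>c. Domain (e c)) = UNIV"
    if "extendable G M \<and> M \<in> sets borel" for M
    using extendable_extensions that by simp
  obtain S where S: "\<And>t::nat. extendable G (S t) \<and> S t \<in> sets borel"
    "\<And>t. S t \<subseteq> S (Suc t)" "comeager {x. \<forall>n. h n x \<in> (\<Union>t. Domain (S t))}"
    by (rule generic_sequence[of h "\<lambda>M. extendable G M \<and> M \<in> sets borel" "{}" Domain "(\<subseteq>)",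
          OF h(1) start Domain_borel extensions]) (assumption, assumption, rule that)
  define M where "M = (\<Union>t. S t)"
  have M: "M \<in> sets borel" "M \<subseteq> G" "sym M"
    using S(1) unfolding M_def extendable_def by (auto intro!: sym_UNION)
  have enumM: "borel_enumerable M" using M(2) borel_enumerable_subset[OF enumerableG] by blast
  have mono: "S s \<subseteq> S t" if "s \<le> t" for s t using lift_Suc_mono_le[of S, OF S(2) that] .
  have "single_valued M"
  proof (rule single_valuedI)
    fix x y z assume "(x, y) \<in> M" "(x, z) \<in> M"
    then obtain s t where "(x, y) \<in> S s" "(x, z) \<in> S t" by (auto simp: M_def)
    then have "(x, y) \<in> S (max s t)" "(x, z) \<in> S (max s t)"
      using mono[of s "max s t"] mono[of t "max s t"] by auto
    moreover have "single_valued (S (max s t))" using S(1) by (simp add: extendable_def)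
    ultimately show "y = z" by (simp add: single_valued_def)
  qed
  define C where "C = {x. \<forall>y. (x, y) \<in> G\<^sup>* \<longrightarrow> y \<in> Domain M}"
  have "comeager C"
  proof -
    have "{x. \<forall>n. h n x \<in> (\<Union>t. Domain (S t))} \<subseteq> C"
    proof
      fix x assume x: "x \<in> {x. \<forall>n. h n x \<in> (\<Union>t. Domain (S t))}"
      have "y \<in> Domain M" if "(x, y) \<in> G\<^sup>*" for y
      proof -
        from h(2)[OF that] obtain n where "y = h n x" ..
        then have "y \<in> (\<Union>t. Domain (S t))" using x by simp
        then show ?thesis by (auto simp: M_def)
      qed
      then show "x \<in> C" by (simp add: C_def)
    qed
    then have "- C \<subseteq> - {x. \<forall>n. h n x \<in> (\<Union>t. Domain (S t))}" by blast
    then show ?thesis using S(3) meager_subset unfolding comeager_def by blast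
  qed
  moreover have "graph_invariant G C"
    using sym_component by (intro graph_invariantI[OF symG]) (auto simp: C_def intro: rtrancl_trans)
  moreover have C_borel: "C \<in> sets borel"
  proof -
    have DM: "Domain M \<in> sets borel" using M(1) enumM by (rule borel_Domain)
    have "{p. (fst p, snd p) \<in> G\<^sup>* \<and> \<not> snd p \<in> Domain M} \<in> sets borel" (is "?R \<in> _")
      by (intro borel_Collect borel_pred_intros borel_component pred_sets2[OF DM])
    moreover have "borel_enumerable ?R"
      by (rule borel_enumerable_subset[OF enumerable_component]) auto
    ultimately have "Domain ?R \<in> sets borel" by (rule borel_Domain)
    moreover have "C = - Domain ?R" unfolding C_def by force
    ultimately show ?thesis by (simp add: borel_comp)
  qed
  moreover have "has_borel_perfect_matching C (G \<inter> (C \<times> C))"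
  proof (rule has_borel_perfect_matchingI[OF C_borel M(1) enumM M(2,3) \<open>single_valued M\<close>])
    show "x \<in> Domain M" if "x \<in> C" for x using that by (auto simp: C_def)
    show "y \<in> C" if "(x, y) \<in> M" "x \<in> C" for x y
    proof -
      have "(x, y) \<in> G" using that(1) M(2) by blast
      then show ?thesis using that(2) unfolding C_def by (blast intro: converse_rtrancl_into_rtrancl
            rtrancl_trans)
    qed
  qed
  ultimately show ?thesis by blast
qed

end
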